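(* Let $G$ be a locally compact Hausdorff topological group, let $H\le G$ be a closed cocompact subgroup, let $n\in\mathbb N$, and let $\chi\colon G\to\mathbb R$ be a character. Then $$\chi\in\Sigma^n_{\mathrm{top}}(G)\iff\chi|_H\in\Sigma^n_{\mathrm{top}}(H).$$
   Context: $\mathbb N$ contains $0$. A character on a locally compact Hausdorff group $G$ is a continuous homomorphism $\chi\colon G\to\mathbb R$; $G_\chi:=\{g\in G\mid\chi(g)\ge0\}$. A subgroup $H\le G$ is cocompact if there is a compact $C\subseteq G$ with $HC=G$. For a set $S$, $\mathrm E S$ is the simplicial set with $n$-simplices $S^{n+1}$, the $i$-th face (degeneracy) map deleting (doubling) the $i$-th entry. $\mathcal C(G)$ is the poset of compact subsets of $G$ ordered by inclusion. For $C\in\mathcal C(G)$, $G_\chi\cdot\mathrm E C\subseteq \mathrm E G$ is the simplicial subset of all simplices $(gx_0,\dots,gx_k)$ with $g\in G_\chi$, $x_i\in C$. A filtration $(X_\alpha)_{\alpha\in A}$ of a connected simplicial set $X$ over a directed poset $A$ (simplicial subsets, increasing in $\alpha$, with union $X$) is essentially $n$-connected if for a vertex $x\in X$ (the choice is immaterial), every $k$ with $0\le k\le n$ and every $\alpha$ with $x\in X_\alpha$, there is $\beta\ge\alpha$ such that $\pi_k(X_\alpha,x)\to\pi_k(X_\beta,x)$ is trivial (homotopy groups are those of geometric realizations); essentially $(-1)$-connected is a vacuous condition. $\Sigma^n_{\mathrm{top}}(G)$ is the set of characters $\chi$ for which the filtration $(G_\chi\cdot \mathrm E C)_{C\in\mathcal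 C(G)}$ of $\mathrm E G$ is essentially $(n-1)$-connected; likewise for the locally compact Hausdorff group $H$ (with the subspace topology). *)

theory Defs
  imports "HOL-Algebra.Coset" "HOL-Homology.Simplices" "HOL-Analysis.Analysis"
begin

section \<open>Simplicial sets\<close>

text \<open>\<open>face X n i\<close> maps \<open>n\<close>-simplices to \<open>(n - 1)\<close>-simplices and is meaningful for \<open>1 \<le> n\<close>, \<open>i \<le> n\<close>;
  \<open>degen X n i\<close> maps \<open>n\<close>-simplices to \<open>(n + 1)\<close>-simplices and is meaningful for \<open>i \<le> n\<close>.\<close>

record 's sset =
  simplices :: "nat \<Rightarrow> 's set"
  face :: "nat \<Rightarrow> nat \<Rightarrow> 's \<Rightarrow> 's"
  degen :: "nat \<Rightarrow> nat \<Rightarrow> 's \<Rightarrow> 's"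

definition simplicial_set :: "'s sset \<Rightarrow> bool" where
  "simplicial_set X \<longleftrightarrow>
     (\<forall>n i x. i \<le> Suc n \<longrightarrow> x \<in> simplices X (Suc n) \<longrightarrow> face X (Suc n) i x \<in> simplices X n) \<and>
     (\<forall>n i x. i \<le> n \<longrightarrow> x \<in> simplices X n \<longrightarrow> degen X n i x \<in> simplices X (Suc n)) \<and>
     (\<forall>n i j x. i < j \<longrightarrow> j \<le> Suc (Suc n) \<longrightarrow> x \<in> simplices X (Suc (Suc n)) \<longrightarrow>
        face X (Suc n) i (face X (Suc (Suc n)) j x)
          = face X (Suc n) (j - 1) (face X (Suc (Suc n)) i x)) \<and>
     (\<forall>n i j x. i < j \<longrightarrow> j \<le> Suc n \<longrightarrow> x \<in> simplices X (Suc n) \<longrightarrow>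
        face X (Suc (Suc n)) i (degen X (Suc n) j x) = degen X n (j - 1) (face X (Suc n) i x)) \<and>
     (\<forall>n j x. j \<le> n \<longrightarrow> x \<in> simplices X n \<longrightarrow>
        face X (Suc n) j (degen X n j x) = x \<and> face X (Suc n) (Suc j) (degen X n j x) = x) \<and>
     (\<forall>n i j x. Suc j < i \<longrightarrow> i \<le> Suc (Suc n) \<longrightarrow> x \<in> simplices X (Suc n) \<longrightarrow>
        face X (Suc (Suc n)) i (degen X (Suc n) j x) = degen X n j (face X (Suc n) (i - 1) x)) \<and>
     (\<forall>n i j x. i \<le> j \<longrightarrow> j \<le> n \<longrightarrow> x \<in> simplices X n \<longrightarrow>
        degen X (Suc n) i (degen X n j x) = degen X (Suc n) (Suc j) (degen X n i x))"

definition simplicial_subset :: "'s sset \<Rightarrow> 's sset \<Rightarrow> bool" where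
  "simplicial_subset Y X \<longleftrightarrow>
     face Y = face X \<and> degen Y = degen X \<and> (\<forall>n. simplices Y n \<subseteq> simplices X n) \<and>
     (\<forall>n i x. i \<le> Suc n \<longrightarrow> x \<in> simplices Y (Suc n) \<longrightarrow> face X (Suc n) i x \<in> simplices Y n) \<and>
     (\<forall>n i x. i \<le> n \<longrightarrow> x \<in> simplices Y n \<longrightarrow> degen X n i x \<in> simplices Y (Suc n))"


section \<open>Geometric realization\<close>

definition quotient_topology :: "'a topology \<Rightarrow> ('a \<times> 'a) set \<Rightarrow> 'a set topology" where
  "quotient_topology T R = topology (\<lambda>U. U \<subseteq> topspace T // R \<and> openin T (\<Union>U))"

lemma openin_quotient_topology:
  assumes "equiv (topspace T) R"
  shows "openin (quotient_topology T R) U \<longleftrightarrow> U \<subseteq> topspace T // R \<and> openin T (\<Union>U)"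
proof -
  have "istopology (\<lambda>U. U \<subseteq> topspace T // R \<and> openin T (\<Union>U))"
    unfolding istopology_def
  proof (intro conjI allI impI)
    fix U V assume *: "U \<subseteq> topspace T // R \<and> openin T (\<Union>U)" "V \<subseteq> topspace T // R \<and> openin T (\<Union>V)"
    have "\<Union>(U \<inter> V) = \<Union>U \<inter> \<Union>V"
    proof
      show "\<Union>U \<inter> \<Union>V \<subseteq> \<Union>(U \<inter> V)"
      proof
        fix x assume "x \<in> \<Union>U \<inter> \<Union>V"
        then obtain A B where "A \<in> U" "x \<in> A" "B \<in> V" "x \<in> B" by blast
        moreover from this have "A = B"
          using * quotient_disj[OF assms] by blast
        ultimately show "x \<in> \<Union>(U \<inter> V)" by blast
      qed
    qed blast
    then show "openin T (\<Union>(U \<inter> V))" using * by auto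
  next
    fix K assume *: "\<forall>U\<in>K. U \<subseteq> topspace T // R \<and> openin T (\<Union>U)"
    have "\<Union>(\<Union>K) = \<Union>(Union ` K)" by blast
    then show "openin T (\<Union>(\<Union>K))" using * by auto
  qed blast+
  then show ?thesis
    unfolding quotient_topology_def by (simp add: topology_inverse')
qed

lemma topspace_quotient_topology:
  assumes "equiv (topspace T) R"
  shows "topspace (quotient_topology T R) = topspace T // R"
proof
  show "topspace (quotient_topology T R) \<subseteq> topspace T // R"
    using openin_topspace[of "quotient_topology T R"]
    unfolding openin_quotient_topology[OF assms] by simp
  have "openin (quotient_topology T R) (topspace T // R)"
    unfolding openin_quotient_topology[OF assms] by (simp add: Union_quotient[OF assms])
  then show "topspace T // R \<subseteq> topspace (quotient_topology T R)"
    by (rule openin_subset)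
qed

lemma quotient_map_quotient_topology:
  assumes "equiv (topspace T) R"
  shows "quotient_map T (quotient_topology T R) (\<lambda>x. R `` {x})"
  unfolding quotient_map_def topspace_quotient_topology[OF assms]
proof (intro conjI allI impI)
  show "(\<lambda>x. R `` {x}) ` topspace T = topspace T // R"
    by (auto simp: quotient_def)
  fix U assume U: "U \<subseteq> topspace T // R"
  have "x \<in> \<Union>U" if "x \<in> topspace T" "R `` {x} \<in> U" for x
    using that equiv_class_self[OF assms] by blast
  moreover have "x \<in> topspace T \<and> R `` {x} \<in> U" if "x \<in> A" "A \<in> U" for x A
  proof -
    have A: "A \<in> topspace T // R" using that U by blast
    then have "x \<in> topspace T" using that in_quotient_imp_subset[OF assms] by blast
    moreover from this have "R `` {x} = A"
      using A that quotientI[of x "topspace T" R] equiv_class_self[OF assms] quotient_disj[OF assms]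
      by blast
    ultimately show ?thesis using that by simp
  qed
  ultimately have "{x \<in> topspace T. R `` {x} \<in> U} = \<Union>U" by blast
  then show "openin T {x \<in> topspace T. R `` {x} \<in> U} = openin (quotient_topology T R) U"
    unfolding openin_quotient_topology[OF assms] using U by simp
qed

text \<open>The coface maps of the standard simplices are \<open>simplical_face\<close>; these are the codegeneracies.\<close>

definition simplicial_degen :: "nat \<Rightarrow> (nat \<Rightarrow> real) \<Rightarrow> nat \<Rightarrow> real" where
  "simplicial_degen i t =
     (\<lambda>j. if j < i then t j else if j = i then t i + t (Suc i) else t (Suc j))"

definition simplex_coproduct :: "'s sset \<Rightarrow> (nat \<times> 's \<times> (nat \<Rightarrow> real)) topology" where
  "simplex_coproduct X =
     sum_topology
       (\<lambda>n. prod_topology (discrete_topology (simplices X n))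
                          (subtopology (powertop_real UNIV) (standard_simplex n)))
       UNIV"

definition realization_glue ::
    "'s sset \<Rightarrow> ((nat \<times> 's \<times> (nat \<Rightarrow> real)) \<times> (nat \<times> 's \<times> (nat \<Rightarrow> real))) set" where
  "realization_glue X =
     {((n, face X (Suc n) i x, t), (Suc n, x, simplical_face i t)) | n i x t.
        i \<le> Suc n \<and> x \<in> simplices X (Suc n) \<and> t \<in> standard_simplex n} \<union>
     {((Suc n, degen X n i x, t), (n, x, simplicial_degen i t)) | n i x t.
        i \<le> n \<and> x \<in> simplices X n \<and> t \<in> standard_simplex (Suc n)}"

definition realization_rel ::
    "'s sset \<Rightarrow> ((nat \<times> 's \<times> (nat \<Rightarrow> real)) \<times> (nat \<times> 's \<times> (nat \<Rightarrow> real))) set" where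
  "realization_rel X =
     (realization_glue X \<union> (realization_glue X)\<inverse>)\<^sup>*
       \<inter> (topspace (simplex_coproduct X) \<times> topspace (simplex_coproduct X))"

lemma equiv_realization_rel: "equiv (topspace (simplex_coproduct X)) (realization_rel X)"
proof (rule equivI)
  show "sym (realization_rel X)"
    unfolding realization_rel_def
    by (intro sym_Int sym_rtrancl) (auto simp: sym_def)
  show "trans (realization_rel X)"
    unfolding realization_rel_def by (auto intro!: transI dest: rtrancl_trans)
qed (auto simp: realization_rel_def refl_on_def)

definition realization :: "'s sset \<Rightarrow> (nat \<times> 's \<times> (nat \<Rightarrow> real)) set topology" where
  "realization X = quotient_topology (simplex_coproduct X) (realization_rel X)"

definition vertex_point :: "'s sset \<Rightarrow> 's \<Rightarrow> (nat \<times> 's \<times> (nat \<Rightarrow> real)) set" where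
  "vertex_point X v = realization_rel X `` {(0, v, \<lambda>i. if i = 0 then 1 else 0)}"

text \<open>The map of realizations induced by an inclusion \<open>Y \<subseteq> X\<close>. It sends the class of a point in \<open>Y\<close>
  to the class of the same point in \<open>X\<close>.\<close>

definition realization_incl ::
    "'s sset \<Rightarrow> (nat \<times> 's \<times> (nat \<Rightarrow> real)) set \<Rightarrow> (nat \<times> 's \<times> (nat \<Rightarrow> real)) set" where
  "realization_incl X c = realization_rel X `` c"


section \<open>Homotopy groups\<close>

text \<open>Pointed homotopy classes of maps from the \<open>k\<close>-sphere. Only the underlying pointed sets are needed:
  a map of homotopy groups (or of pointed sets, for \<open>k = 0\<close>) is trivial iff it sends every class to
  the class of the constant map.\<close>

definition sphere_base :: "nat \<Rightarrow> real" where
  "sphere_base = (\<lambda>i. if i = 0 then 1 else 0)"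

definition based_maps :: "nat \<Rightarrow> 'a topology \<Rightarrow> 'a \<Rightarrow> ((nat \<Rightarrow> real) \<Rightarrow> 'a) set" where
  "based_maps k X x = {f. continuous_map (nsphere k) X f \<and> f sphere_base = x}"

definition based_homotopy ::
    "nat \<Rightarrow> 'a topology \<Rightarrow> 'a \<Rightarrow> (((nat \<Rightarrow> real) \<Rightarrow> 'a) \<times> ((nat \<Rightarrow> real) \<Rightarrow> 'a)) set" where
  "based_homotopy k X x = {(f, g). homotopic_with (\<lambda>h. h sphere_base = x) (nsphere k) X f g}"

definition homotopy_group :: "nat \<Rightarrow> 'a topology \<Rightarrow> 'a \<Rightarrow> ((nat \<Rightarrow> real) \<Rightarrow> 'a) set set" where
  "homotopy_group k X x = based_maps k X x // based_homotopy k X x"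

definition homotopy_unit :: "nat \<Rightarrow> 'a topology \<Rightarrow> 'a \<Rightarrow> ((nat \<Rightarrow> real) \<Rightarrow> 'a) set" where
  "homotopy_unit k X x = based_homotopy k X x `` {\<lambda>_. x}"

text \<open>The map induced by a pointed map \<open>\<phi>\<close> into \<open>(Y, y)\<close>.\<close>

definition homotopy_induced ::
    "nat \<Rightarrow> 'b topology \<Rightarrow> 'b \<Rightarrow> ('a \<Rightarrow> 'b) \<Rightarrow> ((nat \<Rightarrow> real) \<Rightarrow> 'a) set \<Rightarrow> ((nat \<Rightarrow> real) \<Rightarrow> 'b) set" where
  "homotopy_induced k Y y \<phi> c = based_homotopy k Y y `` ((\<lambda>f. \<phi> \<circ> f) ` c)"


section \<open>Filtrations and essential connectedness\<close>

definition filtration :: "'i::order set \<Rightarrow> ('i \<Rightarrow> 's sset) \<Rightarrow> 's sset \<Rightarrow> bool" where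
  "filtration A F X \<longleftrightarrow>
     A \<noteq> {} \<and> (\<forall>a\<in>A. \<forall>b\<in>A. \<exists>c\<in>A. a \<le> c \<and> b \<le> c) \<and>
     simplicial_set X \<and> (\<forall>a\<in>A. simplicial_subset (F a) X) \<and>
     (\<forall>a\<in>A. \<forall>b\<in>A. a \<le> b \<longrightarrow> (\<forall>n. simplices (F a) n \<subseteq> simplices (F b) n)) \<and>
     (\<forall>n. (\<Union>a\<in>A. simplices (F a) n) = simplices X n)"

text \<open>To be used for filtrations of nonempty connected simplicial sets. The bound \<open>m\<close> is an integer
  so that \<open>m = -1\<close> makes sense, in which case the condition on homotopy groups is vacuous.\<close>

definition essentially_connected ::
    "int \<Rightarrow> 'i::order set \<Rightarrow> ('i \<Rightarrow> 's sset) \<Rightarrow> 's sset \<Rightarrow> bool" where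
  "essentially_connected m A F X \<longleftrightarrow>
     (\<exists>x\<in>simplices X 0. \<forall>k. int k \<le> m \<longrightarrow>
        (\<forall>a\<in>A. x \<in> simplices (F a) 0 \<longrightarrow>
           (\<exists>b\<in>A. a \<le> b \<and>
              (\<forall>c\<in>homotopy_group k (realization (F a)) (vertex_point (F a) x).
                 homotopy_induced k (realization (F b)) (vertex_point (F b) x)
                     (realization_incl (F b)) c
                   = homotopy_unit k (realization (F b)) (vertex_point (F b) x)))))"


section \<open>Locally compact groups and characters\<close>

locale topological_group = group G for G (structure) +
  fixes T :: "'a topology"
  assumes topspace_eq_carrier: "topspace T = carrier G"
    and continuous_mult: "continuous_map (prod_topology T T) T (\<lambda>(x, y). x \<otimes> y)"
    and continuous_inv: "continuous_map T T (\<lambda>x. inv x)"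

locale lc_hausdorff_group = topological_group +
  assumes locally_compact: "locally_compact_space T"
    and Hausdorff: "Hausdorff_space T"

lemma (in lc_hausdorff_group) closed_subgroup:
  assumes H: "subgroup H G" "closedin T H"
  shows "lc_hausdorff_group (G\<lparr>carrier := H\<rparr>) (subtopology T H)"
proof -
  have HG: "H \<subseteq> carrier G" using H(1) by (rule subgroup.subset)
  interpret K: group "G\<lparr>carrier := H\<rparr>"
    using subgroup.subgroup_is_group[OF H(1) is_group] .
  show ?thesis
  proof unfold_locales
    show "topspace (subtopology T H) = carrier (G\<lparr>carrier := H\<rparr>)"
      using HG by (auto simp: topspace_eq_carrier)
    have "continuous_map (subtopology (prod_topology T T) (H \<times> H)) T (\<lambda>(x, y). x \<otimes> y)"
      using continuous_mult by (rule continuous_map_from_subtopology)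
    then show "continuous_map (prod_topology (subtopology T H) (subtopology T H)) (subtopology T H)
        (\<lambda>(x, y). x \<otimes>\<^bsub>G\<lparr>carrier := H\<rparr>\<^esub> y)"
      using H(1) by (auto simp: continuous_map_in_subtopology subtopology_Times subgroup.m_closed)
    have "continuous_map (subtopology T H) (subtopology T H) (\<lambda>x. inv x)"
      using continuous_map_from_subtopology[OF continuous_inv] H(1)
      by (auto simp: continuous_map_in_subtopology subgroup.m_inv_closed)
    then show "continuous_map (subtopology T H) (subtopology T H) (\<lambda>x. inv\<^bsub>G\<lparr>carrier := H\<rparr>\<^esub> x)"
      by (rule continuous_map_eq) (use H(1) in \<open>auto simp: m_inv_consistent\<close>)
    show "locally_compact_space (subtopology T H)"
      using locally_compact_space_closed_subset[OF locally_compact H(2)] .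
    show "Hausdorff_space (subtopology T H)"
      using Hausdorff by (rule Hausdorff_space_subtopology)
  qed
qed

definition character :: "('a, 'b) monoid_scheme \<Rightarrow> 'a topology \<Rightarrow> ('a \<Rightarrow> real) \<Rightarrow> bool" where
  "character G T chi \<longleftrightarrow>
     continuous_map T euclideanreal chi \<and>
     (\<forall>x\<in>carrier G. \<forall>y\<in>carrier G. chi (x \<otimes>\<^bsub>G\<^esub> y) = chi x + chi y)"

definition half_group :: "('a, 'b) monoid_scheme \<Rightarrow> ('a \<Rightarrow> real) \<Rightarrow> 'a set" where
  "half_group G chi = {g \<in> carrier G. 0 \<le> chi g}"

definition cocompact :: "('a, 'b) monoid_scheme \<Rightarrow> 'a topology \<Rightarrow> 'a set \<Rightarrow> bool" where
  "cocompact G T H \<longleftrightarrow> (\<exists>C. compactin T C \<and> H <#>\<^bsub>G\<^esub> C = carrier G)"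


section \<open>The filtration and the invariants\<close>

definition delete_nth :: "nat \<Rightarrow> 'a list \<Rightarrow> 'a list" where
  "delete_nth i xs = take i xs @ drop (Suc i) xs"

definition double_nth :: "nat \<Rightarrow> 'a list \<Rightarrow> 'a list" where
  "double_nth i xs = take (Suc i) xs @ drop i xs"

text \<open>An \<open>n\<close>-simplex of \<open>E S\<close> is a list of length \<open>n + 1\<close> over \<open>S\<close>.\<close>

definition E_sset :: "'a set \<Rightarrow> 'a list sset" where
  "E_sset S =
     \<lparr>simplices = (\<lambda>n. {xs. length xs = Suc n \<and> set xs \<subseteq> S}),
      face = (\<lambda>n. delete_nth),
      degen = (\<lambda>n. double_nth)\<rparr>"

definition half_translates ::
    "('a, 'b) monoid_scheme \<Rightarrow> ('a \<Rightarrow> real) \<Rightarrow> 'a set \<Rightarrow> 'a list sset" where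
  "half_translates G chi C = (E_sset (carrier G))
     \<lparr>simplices := (\<lambda>n. {map (\<lambda>x. g \<otimes>\<^bsub>G\<^esub> x) xs | g xs.
        g \<in> half_group G chi \<and> xs \<in> simplices (E_sset C) n})\<rparr>"

definition Sigma_top :: "nat \<Rightarrow> ('a, 'b) monoid_scheme \<Rightarrow> 'a topology \<Rightarrow> ('a \<Rightarrow> real) set" where
  "Sigma_top n G T =
     {chi. character G T chi \<and>
          essentially_connected (int n - 1) {C. compactin T C} (half_translates G chi)
            (E_sset (carrier G))}"

lemma length_delete_nth: "i < length xs \<Longrightarrow> length (delete_nth i xs) = length xs - 1"
  by (simp add: delete_nth_def)

lemma length_double_nth: "i < length xs \<Longrightarrow> length (double_nth i xs) = Suc (length xs)"
  by (simp add: double_nth_def)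

lemma nth_delete_nth:
  "i < length xs \<Longrightarrow> k < length xs - 1 \<Longrightarrow>
     delete_nth i xs ! k = (if k < i then xs ! k else xs ! Suc k)"
  by (auto simp: delete_nth_def nth_append min_def)

lemma nth_double_nth:
  "i < length xs \<Longrightarrow> k < Suc (length xs) \<Longrightarrow>
     double_nth i xs ! k = (if k \<le> i then xs ! k else xs ! (k - 1))"
  by (auto simp: double_nth_def nth_append min_def intro!: arg_cong[where f = "(!) xs"])

lemma set_delete_nth: "set (delete_nth i xs) \<subseteq> set xs"
  by (auto simp: delete_nth_def dest: in_set_takeD in_set_dropD)

lemma set_double_nth: "set (double_nth i xs) \<subseteq> set xs"
  by (auto simp: double_nth_def dest: in_set_takeD in_set_dropD)

lemma map_delete_nth: "map f (delete_nth i xs) = delete_nth i (map f xs)"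
  by (simp add: delete_nth_def take_map drop_map)

lemma map_double_nth: "map f (double_nth i xs) = double_nth i (map f xs)"
  by (simp add: double_nth_def take_map drop_map)

lemma simplicial_set_E_sset: "simplicial_set (E_sset S)"
proof -
  note d = length_delete_nth nth_delete_nth
  note s = length_double_nth nth_double_nth
  have "delete_nth i (delete_nth j xs) = delete_nth (j - 1) (delete_nth i xs)"
    if "i < j" "j < length xs" for i j and xs :: "'a list"
    by (rule nth_equalityI) (use that in \<open>auto simp: d\<close>)
  moreover have "delete_nth i (double_nth j xs) = double_nth (j - 1) (delete_nth i xs)"
    if "i < j" "j < length xs" for i j and xs :: "'a list"
    by (rule nth_equalityI) (use that in \<open>auto simp: d s\<close>)
  moreover have "delete_nth j (double_nth j xs) = xs" "delete_nth (Suc j) (double_nth j xs) = xs"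
    if "j < length xs" for j and xs :: "'a list"
    by (rule nth_equalityI; use that in \<open>auto simp: d s\<close>)+
  moreover have "delete_nth i (double_nth j xs) = double_nth j (delete_nth (i - 1) xs)"
    if "Suc j < i" "i \<le> length xs" for i j and xs :: "'a list"
    by (rule nth_equalityI) (use that in \<open>auto simp: d s\<close>)
  moreover have "double_nth i (double_nth j xs) = double_nth (Suc j) (double_nth i xs)"
    if "i \<le> j" "j < length xs" for i j and xs :: "'a list"
    by (rule nth_equalityI) (use that in \<open>auto simp: s\<close>)
  moreover have "set (delete_nth i xs) \<subseteq> S" "set (double_nth i xs) \<subseteq> S"
    if "set xs \<subseteq> S" for i and xs :: "'a list"
    using that set_delete_nth set_double_nth by fast+
  ultimately show ?thesis
    unfolding simplicial_set_def
    by (simp add: E_sset_def length_delete_nth length_double_nth less_Suc_eq_le)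
qed

lemma (in topological_group) filtration_half_translates:
  assumes chi: "character G T chi"
  shows "filtration {C. compactin T C} (half_translates G chi) (E_sset (carrier G))"
proof -
  have sub: "C \<subseteq> carrier G" if "compactin T C" for C
    using compactin_subset_topspace[OF that] by (simp add: topspace_eq_carrier)
  have "chi \<one> = chi \<one> + chi \<one>"
    using chi unfolding character_def by (metis one_closed r_one)
  then have one: "\<one> \<in> half_group G chi"
    by (simp add: half_group_def)
  show ?thesis
    unfolding filtration_def
  proof (intro conjI ballI allI impI)
    show "{C. compactin T C} \<noteq> {}"
      using compactin_empty by blast
    show "simplicial_set (E_sset (carrier G))"
      by (rule simplicial_set_E_sset)
  next
    fix C D assume "C \<in> {C. compactin T C}" "D \<in> {C. compactin T C}"
    then show "\<exists>K\<in>{C. compactin T C}. C \<le> K \<and> D \<le> K"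
      by (intro bexI[of _ "C \<union> D"]) (auto intro: compactin_Un)
  next
    fix C assume "C \<in> {C. compactin T C}"
    then have C: "C \<subseteq> carrier G" using sub by blast
    have face: "delete_nth i (map (\<lambda>x. g \<otimes> x) xs)
          \<in> {map (\<lambda>x. g \<otimes> x) xs | g xs. g \<in> half_group G chi \<and> xs \<in> simplices (E_sset C) n}"
      if "g \<in> half_group G chi" "xs \<in> simplices (E_sset C) (Suc n)" "i \<le> Suc n" for g xs i n
      using that set_delete_nth[of i xs]
      by (auto simp: E_sset_def length_delete_nth map_delete_nth[symmetric]
          intro!: exI[of _ g] exI[of _ "delete_nth i xs"])
    have degen: "double_nth i (map (\<lambda>x. g \<otimes> x) xs)
          \<in> {map (\<lambda>x. g \<otimes> x) xs | g xs. g \<in> half_group G chi \<and> xs \<in> simplices (E_sset C) (Suc n)}"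
      if "g \<in> half_group G chi" "xs \<in> simplices (E_sset C) n" "i \<le> n" for g xs i n
      using that set_double_nth[of i xs]
      by (auto simp: E_sset_def length_double_nth map_double_nth[symmetric]
          intro!: exI[of _ g] exI[of _ "double_nth i xs"])
    have simp: "simplices (half_translates G chi C) n
        = {map (\<lambda>x. g \<otimes> x) xs | g xs. g \<in> half_group G chi \<and> xs \<in> simplices (E_sset C) n}" for n
      by (simp add: half_translates_def)
    have maps: "face (half_translates G chi C) = face (E_sset (carrier G))"
      "degen (half_translates G chi C) = degen (E_sset (carrier G))"
      "face (E_sset (carrier G)) n = delete_nth" "degen (E_sset (carrier G)) n = double_nth" for n
      by (simp_all add: half_translates_def E_sset_def)
    have incl: "simplices (half_translates G chi C) n \<subseteq> simplices (E_sset (carrier G)) n" for n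
      unfolding simp using C by (auto simp: E_sset_def half_group_def subset_iff)
    show "simplicial_subset (half_translates G chi C) (E_sset (carrier G))"
      unfolding simplicial_subset_def maps
    proof (intro conjI allI impI incl refl)
      fix n i xs assume "i \<le> Suc n" "xs \<in> simplices (half_translates G chi C) (Suc n)"
      then show "delete_nth i xs \<in> simplices (half_translates G chi C) n"
        unfolding simp using face by blast
    next
      fix n i xs assume "i \<le> n" "xs \<in> simplices (half_translates G chi C) n"
      then show "double_nth i xs \<in> simplices (half_translates G chi C) (Suc n)"
        unfolding simp using degen by blast
    qed
  next
    fix C D n assume "C \<le> (D :: 'a set)"
    then have "simplices (E_sset C) n \<subseteq> simplices (E_sset D) n"
      by (auto simp: E_sset_def)
    then show "simplices (half_translates G chi C) n \<subseteq> simplices (half_translates G chi D) n"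
      by (auto simp: half_translates_def)
  next
    fix n
    show "(\<Union>C\<in>{C. compactin T C}. simplices (half_translates G chi C) n)
        = simplices (E_sset (carrier G)) n"
    proof
      show "(\<Union>C\<in>{C. compactin T C}. simplices (half_translates G chi C) n)
          \<subseteq> simplices (E_sset (carrier G)) n"
        using sub by (auto simp: half_translates_def E_sset_def half_group_def subset_iff)
      show "simplices (E_sset (carrier G)) n
          \<subseteq> (\<Union>C\<in>{C. compactin T C}. simplices (half_translates G chi C) n)"
      proof
        fix xs assume xs: "xs \<in> simplices (E_sset (carrier G)) n"
        then have "map (\<lambda>x. \<one> \<otimes> x) xs = xs"
          by (auto simp: E_sset_def intro!: map_idI)
        moreover have "compactin T (set xs)"
          using xs by (intro finite_imp_compactin) (auto simp: E_sset_def topspace_eq_carrier)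
        moreover have "xs \<in> simplices (E_sset (set xs)) n"
          using xs by (auto simp: E_sset_def)
        ultimately show "xs \<in> (\<Union>C\<in>{C. compactin T C}. simplices (half_translates G chi C) n)"
          using one by (auto simp: half_translates_def intro!: exI[of _ "set xs"] exI[of _ \<one>] exI[of _ xs])
      qed
    qed
  qed
qed

end

theory Submission
  imports Defs
begin

text \<open>Write \<open>G = H B\<close> with \<open>B\<close> compact, and choose a retraction \<open>r\<close> of \<open>G\<close> onto \<open>H\<close> with
  \<open>g \<in> r(g) B\<close>. Since \<open>r\<close> moves every element by a bounded amount and \<open>H\<close> is closed, it maps the
  filtration of \<open>E G\<close> into that of \<open>E H\<close> after enlarging the compact set; right multiplication by a fixed
  \<open>s \<in> H\<close> compensates for the bounded loss in the value of the character. On \<open>H\<close> it is the identity, and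
  on \<open>G\<close> it is contiguous to the identity inside a larger stage, because the simplices
  \<open>(x\<^sub>0, \<dots>, x\<^sub>n, r x\<^sub>0, \<dots>, r x\<^sub>n)\<close> lie there. Hence null homotopies can be
  transported in both directions. Fixing the base point \<open>1 = r(1)\<close> is harmless, since left translation by
  any element of \<open>G\<close> is an automorphism of the filtration.\<close>

section \<open>Maps and homotopies of realizations\<close>

text \<open>The pieces \<open>topspace Z \<times> ({i} \<times> topspace (X i))\<close> form an open
  cover, so continuity can be pasted from the summands. For the realization this reduces continuity
  of a homotopy to one simplex dimension at a time.\<close>

lemma continuous_map_prod_sum_topology:
  assumes "\<And>i. i \<in> I \<Longrightarrow> continuous_map (prod_topology Z (X i)) Y (\<lambda>(z, x). f (z, i, x))"
  shows "continuous_map (prod_topology Z (sum_topology X I)) Y f"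
proof (rule pasting_lemma[where I = I and T = "\<lambda>i. topspace Z \<times> ({i} \<times> topspace (X i))" and f = "\<lambda>_. f"])
  fix i assume i: "i \<in> I"
  have sum: "openin (sum_topology X I) ({i} \<times> U)" if "openin (X i) U" for U
  proof -
    have "{x. (j, x) \<in> {i} \<times> U} = (if j = i then U else {})" for j
      by auto
    then show ?thesis
      using i that openin_subset[OF that] by (auto simp: openin_sum_topology)
  qed
  then have sub: "openin (sum_topology X I) ({i} \<times> topspace (X i))"
    by simp
  then show "openin (prod_topology Z (sum_topology X I)) (topspace Z \<times> {i} \<times> topspace (X i))"
    by (simp add: openin_prod_Times_iff)
  have "continuous_map (subtopology (sum_topology X I) ({i} \<times> topspace (X i))) (X i) snd"
    unfolding continuous_map_def
  proof (intro conjI allI impI)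
    fix U assume U: "openin (X i) U"
    have "{w \<in> topspace (subtopology (sum_topology X I) ({i} \<times> topspace (X i))). snd w \<in> U} = {i} \<times> U"
      using openin_subset[OF U] i by auto
    moreover have "openin (sum_topology X I) ({i} \<times> U)"
      using sum[OF U] .
    ultimately show "openin (subtopology (sum_topology X I) ({i} \<times> topspace (X i)))
        {w \<in> topspace (subtopology (sum_topology X I) ({i} \<times> topspace (X i))). snd w \<in> U}"
      using openin_subset[OF U] sub by (auto simp: openin_open_subtopology)
  qed auto
  then have "continuous_map (prod_topology Z (subtopology (sum_topology X I) ({i} \<times> topspace (X i))))
      (prod_topology Z (X i)) (\<lambda>p. (fst p, snd (snd p)))"
    by (intro continuous_map_pairedI continuous_map_fst
        continuous_map_compose[OF continuous_map_snd, unfolded o_def])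
  then have "continuous_map (prod_topology Z (subtopology (sum_topology X I) ({i} \<times> topspace (X i)))) Y
      ((\<lambda>(z, x). f (z, i, x)) \<circ> (\<lambda>p. (fst p, snd (snd p))))"
    by (rule continuous_map_compose) (rule assms[OF i])
  then have "continuous_map (prod_topology Z (subtopology (sum_topology X I) ({i} \<times> topspace (X i)))) Y f"
    by (rule continuous_map_eq) auto
  then show "continuous_map (subtopology (prod_topology Z (sum_topology X I)) (topspace Z \<times> {i} \<times> topspace (X i))) Y f"
    by (simp add: subtopology_Times)
qed auto

section \<open>Coface and codegeneracy maps of the standard simplices\<close>

lemma simplical_face_in_standard_simplex:
  assumes t: "t \<in> standard_simplex n" and i: "i \<le> Suc n"
  shows "simplical_face i t \<in> standard_simplex (Suc n)"
proof -
  have "(\<Sum>j\<le>Suc n. simplical_face i t j) = (\<Sum>j\<le>n. t j)"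
  proof -
    have "(\<Sum>j\<le>Suc n. simplical_face i t j) = (\<Sum>j\<in>{..Suc n} - {i}. simplical_face i t j)"
      using i by (intro sum.mono_neutral_right) (auto simp: simplical_face_def)
    also have "\<dots> = (\<Sum>j\<le>n. t j)"
      using i by (intro sum.reindex_bij_witness[where j = "\<lambda>j. if j < i then j else j - 1"
            and i = "\<lambda>j. if j < i then j else Suc j"]) (auto simp: simplical_face_def)
    finally show ?thesis .
  qed
  then show ?thesis
    using assms by (auto simp: standard_simplex_def simplical_face_def)
qed

text \<open>Nonnegative coordinates with sum one are automatically at most one, so the upper bound
  in \<open>standard_simplex\<close> need not be checked separately.\<close>

lemma standard_simplexI:
  assumes "\<And>i. 0 \<le> t i" "\<And>i. n < i \<Longrightarrow> t i = 0" "(\<Sum>i\<le>n. t i) = 1"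
  shows "t \<in> standard_simplex n"
proof -
  have "t i \<le> 1" for i
  proof (cases "i \<le> n")
    case True
    then show ?thesis using member_le_sum[of i "{..n}" t] assms by auto
  qed (use assms in auto)
  then show ?thesis using assms by (auto simp: standard_simplex_def)
qed

lemma simplicial_degen_in_standard_simplex:
  assumes t: "t \<in> standard_simplex (Suc n)" and i: "i \<le> n"
  shows "simplicial_degen i t \<in> standard_simplex n"
proof (rule standard_simplexI)
  \<comment> \<open>Partial sums make the induction work: once \<open>m\<close> reaches the merged
    index \<open>i\<close>, the sum has absorbed one further coordinate of \<open>t\<close>.\<close>
  have "(\<Sum>j\<le>m. simplicial_degen i t j) = (\<Sum>j\<le>(if i \<le> m then Suc m else m). t j)" for m
    by (induction m) (auto simp: simplicial_degen_def le_Suc_eq)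
  from this[of n] show "(\<Sum>j\<le>n. simplicial_degen i t j) = 1"
    using assms by (auto simp: standard_simplex_def)
qed (use assms in \<open>auto simp: standard_simplex_def simplicial_degen_def\<close>)

section \<open>Points of a realization and the generating identifications\<close>

lemma topspace_simplex_coproduct:
  "topspace (simplex_coproduct X) = {(n, x, t). x \<in> simplices X n \<and> t \<in> standard_simplex n}"
  by (auto simp: simplex_coproduct_def)

lemma topspace_realization:
  "topspace (realization X) = topspace (simplex_coproduct X) // realization_rel X"
  unfolding realization_def by (rule topspace_quotient_topology[OF equiv_realization_rel])

lemma simplicial_subset_E_ssetD:
  assumes "simplicial_subset X (E_sset A)"
  shows "face X = (\<lambda>n. delete_nth)" "degen X = (\<lambda>n. double_nth)"
    "xs \<in> simplices X n \<Longrightarrow> length xs = Suc n"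
    "xs \<in> simplices X n \<Longrightarrow> set xs \<subseteq> A"
    "xs \<in> simplices X (Suc n) \<Longrightarrow> i \<le> Suc n \<Longrightarrow> delete_nth i xs \<in> simplices X n"
    "xs \<in> simplices X n \<Longrightarrow> i \<le> n \<Longrightarrow> double_nth i xs \<in> simplices X (Suc n)"
  using assms unfolding simplicial_subset_def by (auto simp: E_sset_def)

text \<open>The faces and degeneracies stay in \<open>X\<close> and the affine maps stay in the
  simplices. Hence the intersection in \<open>realization_rel\<close> discards no generating
  pair.\<close>

lemma realization_glue_subset:
  assumes "simplicial_subset X (E_sset A)"
  shows "realization_glue X \<subseteq> topspace (simplex_coproduct X) \<times> topspace (simplex_coproduct X)"
  unfolding realization_glue_def topspace_simplex_coproduct
  using simplicial_subset_E_ssetD[OF assms] simplical_face_in_standard_simplex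
    simplicial_degen_in_standard_simplex
  by auto

lemma realization_class_eq:
  assumes "simplicial_subset X (E_sset A)" "(p, q) \<in> realization_glue X"
  shows "realization_rel X `` {p} = realization_rel X `` {q}"
  by (rule equiv_class_eq[OF equiv_realization_rel])
    (use assms realization_glue_subset[OF assms(1)] in \<open>auto simp: realization_rel_def\<close>)

lemma realization_class_face:
  assumes "simplicial_subset X (E_sset A)"
    and "xs \<in> simplices X (Suc n)" "i \<le> Suc n" "t \<in> standard_simplex n"
  shows "realization_rel X `` {(n, delete_nth i xs, t)} = realization_rel X `` {(Suc n, xs, simplical_face i t)}"
  by (rule realization_class_eq[OF assms(1)])
    (use assms simplicial_subset_E_ssetD(1,2)[OF assms(1)] in \<open>auto simp: realization_glue_def\<close>)

lemma realization_class_degen: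
  assumes "simplicial_subset X (E_sset A)"
    and "xs \<in> simplices X n" "i \<le> n" "t \<in> standard_simplex (Suc n)"
  shows "realization_rel X `` {(Suc n, double_nth i xs, t)} = realization_rel X `` {(n, xs, simplicial_degen i t)}"
  by (rule realization_class_eq[OF assms(1)])
    (use assms simplicial_subset_E_ssetD(1,2)[OF assms(1)] in \<open>auto simp: realization_glue_def\<close>)

section \<open>Continuous maps and homotopies out of a realization\<close>

lemma realization_rel_invariant:
  assumes X: "simplicial_subset X (E_sset A)"
    and face: "\<And>n i xs t. xs \<in> simplices X (Suc n) \<Longrightarrow> i \<le> Suc n \<Longrightarrow> t \<in> standard_simplex n \<Longrightarrow>
      h (n, delete_nth i xs, t) = h (Suc n, xs, simplical_face i t)"
    and degen: "\<And>n i xs t. xs \<in> simplices X n \<Longrightarrow> i \<le> n \<Longrightarrow> t \<in> standard_simplex (Suc n) \<Longrightarrow>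
      h (Suc n, double_nth i xs, t) = h (n, xs, simplicial_degen i t)"
    and "(p, q) \<in> realization_rel X"
  shows "h p = h q"
proof -
  have glue: "h p = h q" if "(p, q) \<in> realization_glue X" for p q
    using that face degen unfolding realization_glue_def simplicial_subset_E_ssetD(1,2)[OF X] by auto
  have "(p, q) \<in> (realization_glue X \<union> (realization_glue X)\<inverse>)\<^sup>*"
    using assms(4) by (simp add: realization_rel_def)
  then show ?thesis
    by (induction rule: rtrancl_induct) (use glue in force)+
qed

text \<open>The unit interval is locally compact Hausdorff, so its product with the quotient map
  onto the realization is again a quotient map. A homotopy on the coproduct that respects the
  generating identifications at each time therefore descends.\<close>

lemma realization_lift_homotopy:
  fixes h :: "real \<Rightarrow> nat \<times> 'a list \<times> (nat \<Rightarrow> real) \<Rightarrow> 'b"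
  assumes X: "simplicial_subset X (E_sset A)"
    and cont: "\<And>n. continuous_map (prod_topology (top_of_set {0..1}) (prod_topology
        (discrete_topology (simplices X n)) (subtopology (powertop_real UNIV) (standard_simplex n)))) Z
        (\<lambda>(s, x, t). h s (n, x, t))"
    and face: "\<And>s n i xs t. s \<in> {0..1} \<Longrightarrow> xs \<in> simplices X (Suc n) \<Longrightarrow> i \<le> Suc n \<Longrightarrow>
      t \<in> standard_simplex n \<Longrightarrow> h s (n, delete_nth i xs, t) = h s (Suc n, xs, simplical_face i t)"
    and degen: "\<And>s n i xs t. s \<in> {0..1} \<Longrightarrow> xs \<in> simplices X n \<Longrightarrow> i \<le> n \<Longrightarrow>
      t \<in> standard_simplex (Suc n) \<Longrightarrow> h s (Suc n, double_nth i xs, t) = h s (n, xs, simplicial_degen i t)"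
  obtains K where "continuous_map (prod_topology (top_of_set {0..1}) (realization X)) Z K"
    "\<And>s p. s \<in> {0..1} \<Longrightarrow> p \<in> topspace (simplex_coproduct X) \<Longrightarrow> K (s, realization_rel X `` {p}) = h s p"
proof -
  let ?I = "top_of_set {0..1::real}"
  have Q: "quotient_map (prod_topology ?I (simplex_coproduct X)) (prod_topology ?I (realization X))
      (\<lambda>(s, p). (s, realization_rel X `` {p}))"
  proof (rule quotient_map_prod_right)
    show "locally_compact_space ?I"
      by (intro compact_imp_locally_compact_space) (auto simp: compact_space_subtopology)
    show "Hausdorff_space ?I \<or> regular_space ?I"
      by (simp add: Hausdorff_space_subtopology)
    show "quotient_map (simplex_coproduct X) (realization X) (\<lambda>p. realization_rel X `` {p})"
      unfolding realization_def by (rule quotient_map_quotient_topology[OF equiv_realization_rel])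
  qed
  have hcont: "continuous_map (prod_topology ?I (simplex_coproduct X)) Z (\<lambda>(s, p). h s p)"
    unfolding simplex_coproduct_def
  proof (rule continuous_map_prod_sum_topology)
    fix n
    show "continuous_map (prod_topology ?I (prod_topology
        (discrete_topology (simplices X n)) (subtopology (powertop_real UNIV) (standard_simplex n)))) Z
        (\<lambda>(z, x). case (z, n, x) of (s, p) \<Rightarrow> h s p)"
      using cont[of n] by (simp add: case_prod_unfold)
  qed
  have hinv: "(\<lambda>(s, p). h s p) z = (\<lambda>(s, p). h s p) w"
    if "z \<in> topspace (prod_topology ?I (simplex_coproduct X))"
      "w \<in> topspace (prod_topology ?I (simplex_coproduct X))"
      "(\<lambda>(s, p). (s, realization_rel X `` {p})) z = (\<lambda>(s, p). (s, realization_rel X `` {p})) w" for z w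
  proof -
    obtain s p s' q where "z = (s, p)" "w = (s', q)"
      by (meson surj_pair)
    with that have zw: "z = (s, p)" "w = (s, q)" "s \<in> {0..1}" "p \<in> topspace (simplex_coproduct X)"
        "q \<in> topspace (simplex_coproduct X)" "realization_rel X `` {p} = realization_rel X `` {q}"
      by simp_all
    then have "(p, q) \<in> realization_rel X"
      using eq_equiv_class[OF _ equiv_realization_rel] by blast
    then have "h s p = h s q"
      using realization_rel_invariant[OF X, of "h s"] face degen zw(3) by blast
    then show ?thesis using zw by simp
  qed
  show ?thesis
  proof (rule quotient_map_lift_exists[OF Q hcont hinv])
    fix K
    assume K: "continuous_map (prod_topology ?I (realization X)) Z K"
      "\<And>z. z \<in> topspace (prod_topology ?I (simplex_coproduct X)) \<Longrightarrow>
         K ((\<lambda>(s, p). (s, realization_rel X `` {p})) z) = (\<lambda>(s, p). h s p) z"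
    show thesis
    proof (rule that[OF K(1)])
      fix s :: real and p assume "s \<in> {0..1}" "p \<in> topspace (simplex_coproduct X)"
      then show "K (s, realization_rel X `` {p}) = h s p" using K(2)[of "(s, p)"] by simp
    qed
  qed
qed

lemma continuous_map_into_realization:
  assumes "continuous_map W (prod_topology (discrete_topology (simplices Y m))
      (subtopology (powertop_real UNIV) (standard_simplex m))) u"
  shows "continuous_map W (realization Y) (\<lambda>w. realization_rel Y `` {(m, u w)})"
proof -
  have 1: "continuous_map (prod_topology (discrete_topology (simplices Y m))
      (subtopology (powertop_real UNIV) (standard_simplex m))) (simplex_coproduct Y) (Pair m)"
    unfolding simplex_coproduct_def
    by (rule continuous_map_component_injection[where X = "\<lambda>n. prod_topology (discrete_topology (simplices Y n))
                          (subtopology (powertop_real UNIV) (standard_simplex n))"]) simp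
  have 2: "continuous_map (simplex_coproduct Y) (realization Y) (\<lambda>p. realization_rel Y `` {p})"
    unfolding realization_def
    by (intro quotient_imp_continuous_map quotient_map_quotient_topology equiv_realization_rel)
  show ?thesis
    using continuous_map_compose[OF continuous_map_compose[OF assms 1] 2] by (simp add: o_def)
qed

lemma realization_map:
  assumes X: "simplicial_subset X (E_sset A)" and Y: "simplicial_subset Y (E_sset B)"
    and \<phi>: "\<And>n xs. xs \<in> simplices X n \<Longrightarrow> map \<phi> xs \<in> simplices Y n"
  obtains F where "continuous_map (realization X) (realization Y) F"
    "\<And>n xs t. xs \<in> simplices X n \<Longrightarrow> t \<in> standard_simplex n \<Longrightarrow>
      F (realization_rel X `` {(n, xs, t)}) = realization_rel Y `` {(n, map \<phi> xs, t)}"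
proof -
  \<comment> \<open>The time \<open>s\<close> is a dummy: a single map is obtained by descending a
    constant homotopy and evaluating it at time 0.\<close>
  let ?h = "\<lambda>(s::real) (n, xs, t). realization_rel Y `` {(n, map \<phi> xs, t)}"
  obtain K where K: "continuous_map (prod_topology (top_of_set {0..1}) (realization X)) (realization Y) K"
    "\<And>s p. s \<in> {0..1} \<Longrightarrow> p \<in> topspace (simplex_coproduct X) \<Longrightarrow> K (s, realization_rel X `` {p}) = ?h s p"
  proof (rule realization_lift_homotopy[OF X, of "realization Y" ?h])
    fix n
    let ?W = "prod_topology (top_of_set {0..1::real}) (prod_topology
        (discrete_topology (simplices X n)) (subtopology (powertop_real UNIV) (standard_simplex n)))"
    have "continuous_map ?W (discrete_topology (simplices X n)) (\<lambda>w. fst (snd w))"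
      "continuous_map ?W (subtopology (powertop_real UNIV) (standard_simplex n)) (\<lambda>w. snd (snd w))"
      by (intro continuous_map_compose[OF continuous_map_snd, unfolded o_def]
          continuous_map_fst continuous_map_snd)+
    moreover have "continuous_map (discrete_topology (simplices X n)) (discrete_topology (simplices Y n)) (map \<phi>)"
      using \<phi> by auto
    ultimately have "continuous_map ?W (prod_topology (discrete_topology (simplices Y n))
      (subtopology (powertop_real UNIV) (standard_simplex n))) (\<lambda>w. (map \<phi> (fst (snd w)), snd (snd w)))"
      by (intro continuous_map_pairedI) (use continuous_map_compose[unfolded o_def] in blast)+
    from continuous_map_into_realization[OF this]
    show "continuous_map ?W (realization Y) (\<lambda>(s, x, t). ?h s (n, x, t))"
      by (simp add: case_prod_unfold)
  next
    fix s :: real and n i xs t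
    assume *: "xs \<in> simplices X (Suc n)" "i \<le> Suc n" "t \<in> standard_simplex n"
    then show "?h s (n, delete_nth i xs, t) = ?h s (Suc n, xs, simplical_face i t)"
      using realization_class_face[OF Y \<phi>[OF *(1)] *(2,3)] by (simp add: map_delete_nth)
  next
    fix s :: real and n i xs t
    assume *: "xs \<in> simplices X n" "i \<le> n" "t \<in> standard_simplex (Suc n)"
    then show "?h s (Suc n, double_nth i xs, t) = ?h s (n, xs, simplicial_degen i t)"
      using realization_class_degen[OF Y \<phi>[OF *(1)] *(2,3)] by (simp add: map_double_nth)
  qed blast
  show ?thesis
  proof (rule that)
    have "continuous_map (realization X) (prod_topology (top_of_set {0..1}) (realization X)) (\<lambda>z. (0::real, z))"
      by (intro continuous_map_pairedI) auto
    from continuous_map_compose[OF this K(1)]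
    show "continuous_map (realization X) (realization Y) (\<lambda>z. K (0, z))" by (simp add: o_def)
  qed (use K(2)[of 0] in \<open>auto simp: topspace_simplex_coproduct\<close>)
qed

section \<open>Joins and the straight-line homotopy\<close>

text \<open>The standard simplex of dimension 2n+1 is the join of two standard n-simplices. This is
  the point at time \<open>s\<close> on the segment from \<open>t\<close> in the front copy to
  \<open>t\<close> in the back copy.\<close>

definition simplex_join :: "nat \<Rightarrow> real \<Rightarrow> (nat \<Rightarrow> real) \<Rightarrow> nat \<Rightarrow> real" where
  "simplex_join n s t = (\<lambda>i. if i \<le> n then (1 - s) * t i else s * t (i - Suc n))"

lemma simplex_join_in_standard_simplex:
  assumes s: "s \<in> {0..1}" and t: "t \<in> standard_simplex n"
  shows "simplex_join n s t \<in> standard_simplex (Suc (n + n))"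
proof (rule standard_simplexI)
  show "0 \<le> simplex_join n s t i" for i
    using assms by (auto simp: simplex_join_def standard_simplex_def)
  show "simplex_join n s t i = 0" if "Suc (n + n) < i" for i
    using assms that by (auto simp: simplex_join_def standard_simplex_def)
  \<comment> \<open>The induction runs over the number \<open>m\<close> of coordinates taken from
    the second copy; \<open>m = Suc n\<close> exhausts it.\<close>
  have *: "(\<Sum>i\<le>n + m. simplex_join n s t i)
      = (1 - s) * (\<Sum>i\<le>n. t i) + s * (\<Sum>i<m. t i)" for m
    by (induction m) (auto simp: simplex_join_def sum_distrib_left algebra_simps)
  show "(\<Sum>i\<le>Suc (n + n). simplex_join n s t i) = 1"
    using *[of "Suc n"] t by (auto simp: standard_simplex_def lessThan_Suc_atMost)
qed

lemma continuous_map_simplex_join: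
  "continuous_map (prod_topology (top_of_set {0..1})
      (prod_topology D (subtopology (powertop_real UNIV) (standard_simplex n))))
    (subtopology (powertop_real UNIV) (standard_simplex (Suc (n + n))))
    (\<lambda>w. simplex_join n (fst w) (snd (snd w)))" (is "continuous_map ?W _ _")
proof -
  have s: "continuous_map ?W euclideanreal fst"
    by (rule continuous_map_into_fulltopology[OF continuous_map_fst])
  have "continuous_map ?W (powertop_real UNIV) (\<lambda>w. snd (snd w))"
    by (rule continuous_map_into_fulltopology[OF
          continuous_map_compose[OF continuous_map_snd continuous_map_snd, unfolded o_def]])
  then have t: "continuous_map ?W euclideanreal (\<lambda>w. snd (snd w) i)" for i
    by (simp add: continuous_map_componentwise_UNIV)
  have "continuous_map ?W euclideanreal (\<lambda>w. simplex_join n (fst w) (snd (snd w)) i)" for i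
    by (cases "i \<le> n") (auto simp: simplex_join_def intro!: continuous_intros s t)
  then show ?thesis
    unfolding continuous_map_in_subtopology continuous_map_componentwise_UNIV
    by (auto intro!: simplex_join_in_standard_simplex)
qed

lemma delete_nth_append:
  "delete_nth i (xs @ ys) = (if i < length xs then delete_nth i xs @ ys else xs @ delete_nth (i - length xs) ys)"
  by (simp add: delete_nth_def Suc_diff_le)

lemma double_nth_append:
  "double_nth i (xs @ ys) = (if i < length xs then double_nth i xs @ ys else xs @ double_nth (i - length xs) ys)"
  by (simp add: double_nth_def Suc_diff_le)

text \<open>Deleting entry \<open>i\<close> from both halves is a composite of two faces, at
  \<open>i\<close> and at the corresponding index \<open>Suc (Suc n) + i\<close> of the second half.
  On coordinates these insert a zero into each copy of \<open>t\<close>, which is what joining after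
  \<open>simplical_face i\<close> gives.\<close>

lemma realization_class_join_face:
  assumes X: "simplicial_subset X (E_sset A)"
    and xs: "xs @ ys \<in> simplices X (Suc (Suc n + Suc n))" "length xs = Suc (Suc n)" "length ys = Suc (Suc n)"
    and i: "i \<le> Suc n" and t: "t \<in> standard_simplex n" and s: "s \<in> {0..1}"
  shows "realization_rel X `` {(Suc (n + n), delete_nth i xs @ delete_nth i ys, simplex_join n s t)}
    = realization_rel X `` {(Suc (Suc n + Suc n), xs @ ys, simplex_join (Suc n) s (simplical_face i t))}"
proof -
  have j: "Suc (Suc n) + i \<le> Suc (Suc n + Suc n)" using i by simp
  have z: "xs @ ys \<in> simplices X (Suc (Suc (Suc (n + n))))" using xs(1) by simp
  have d: "xs @ delete_nth i ys \<in> simplices X (Suc (Suc (n + n)))"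
    using simplicial_subset_E_ssetD(5)[OF X z, of "Suc (Suc n) + i"] i xs by (simp add: delete_nth_append)
  have st: "simplex_join n s t \<in> standard_simplex (Suc (n + n))"
    using simplex_join_in_standard_simplex s t by blast
  have "realization_rel X `` {(Suc (n + n), delete_nth i xs @ delete_nth i ys, simplex_join n s t)}
    = realization_rel X `` {(Suc (Suc (n + n)), xs @ delete_nth i ys, simplical_face i (simplex_join n s t))}"
    using realization_class_face[OF X d _ st, of i] i xs by (simp add: delete_nth_append)
  also have "\<dots> = realization_rel X `` {(Suc (Suc (Suc (n + n))), xs @ ys,
      simplical_face (Suc (Suc n) + i) (simplical_face i (simplex_join n s t)))}"
    using realization_class_face[OF X z _ simplical_face_in_standard_simplex[OF st], of "Suc (Suc n) + i" i] i xs
    by (simp add: delete_nth_append)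
  also have "simplical_face (Suc (Suc n) + i) (simplical_face i (simplex_join n s t))
      = simplex_join (Suc n) s (simplical_face i t)"
  proof
    fix j
    \<comment> \<open>The index \<open>Suc n\<close> is separate because it belongs to the front
      half for \<open>simplex_join (Suc n)\<close> but to the back half for
      \<open>simplex_join n\<close>.\<close>
    consider "j \<le> n" | "j = Suc n" | k where "j = Suc (Suc n) + k"
      by (metis le_Suc_eq nat_le_iff_add not_less_eq_eq add_Suc)
    then show "simplical_face (Suc (Suc n) + i) (simplical_face i (simplex_join n s t)) j
        = simplex_join (Suc n) s (simplical_face i t) j"
      using i by cases (auto simp: simplical_face_def simplex_join_def Suc_diff_le)
  qed
  finally show ?thesis by simp
qed

text \<open>Two degeneracies, one in each half, double entry \<open>i\<close> simultaneously. The
  second has index \<open>Suc n + i\<close>, since merging coordinates in the front half has already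
  shortened it to \<open>Suc n\<close> coordinates.\<close>

lemma realization_class_join_degen:
  assumes X: "simplicial_subset X (E_sset A)"
    and xs: "xs @ ys \<in> simplices X (Suc (n + n))" "length xs = Suc n" "length ys = Suc n"
    and i: "i \<le> n" and t: "t \<in> standard_simplex (Suc n)" and s: "s \<in> {0..1}"
  shows "realization_rel X `` {(Suc (Suc n + Suc n), double_nth i xs @ double_nth i ys, simplex_join (Suc n) s t)}
    = realization_rel X `` {(Suc (n + n), xs @ ys, simplex_join n s (simplicial_degen i t))}"
proof -
  have d: "xs @ double_nth i ys \<in> simplices X (Suc (Suc (n + n)))"
    using simplicial_subset_E_ssetD(6)[OF X xs(1), of "Suc n + i"] i xs by (simp add: double_nth_append)
  have st: "simplex_join (Suc n) s t \<in> standard_simplex (Suc (Suc (Suc (n + n))))"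
    using simplex_join_in_standard_simplex[OF s t] by simp
  have st': "simplicial_degen i (simplex_join (Suc n) s t) \<in> standard_simplex (Suc (Suc (n + n)))"
    using simplicial_degen_in_standard_simplex[OF st] i by simp
  have "realization_rel X `` {(Suc (Suc (Suc (n + n))), double_nth i xs @ double_nth i ys, simplex_join (Suc n) s t)}
    = realization_rel X `` {(Suc (Suc (n + n)), xs @ double_nth i ys, simplicial_degen i (simplex_join (Suc n) s t))}"
    using realization_class_degen[OF X d _ st, of i] i xs by (simp add: double_nth_append)
  also have "\<dots> = realization_rel X `` {(Suc (n + n), xs @ ys,
      simplicial_degen (Suc n + i) (simplicial_degen i (simplex_join (Suc n) s t)))}"
    using realization_class_degen[OF X xs(1) _ st', of "Suc n + i"] i xs
    by (simp add: double_nth_append)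
  also have "simplicial_degen (Suc n + i) (simplicial_degen i (simplex_join (Suc n) s t))
      = simplex_join n s (simplicial_degen i t)"
  proof
    fix j
    consider "j < n" | "j = n" | k where "j = Suc n + k"
      by (metis le_Suc_ex linorder_neqE_nat Suc_leI)
    then show "simplicial_degen (Suc n + i) (simplicial_degen i (simplex_join (Suc n) s t)) j
        = simplex_join n s (simplicial_degen i t) j"
      using i by cases (auto simp: simplicial_degen_def simplex_join_def algebra_simps Suc_diff_le)
  qed
  finally show ?thesis by simp
qed

text \<open>The coordinates of \<open>t\<close> beyond \<open>n\<close> vanish, so the appended
  vertices have weight zero and can be removed from the end by last faces. Points are functions
  extended by zero, so \<open>t\<close> itself does not change. This identifies the homotopy at time
  0.\<close>

lemma realization_class_append_right:
  assumes X: "simplicial_subset X (E_sset A)"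
    and "xs @ ys \<in> simplices X (n + length ys)" "length xs = Suc n" "t \<in> standard_simplex n"
  shows "xs \<in> simplices X n \<and>
    realization_rel X `` {(n + length ys, xs @ ys, t)} = realization_rel X `` {(n, xs, t)}"
  using assms(2)
proof (induction ys rule: rev_induct)
  case (snoc y ys)
  let ?m = "n + length ys"
  have z: "xs @ ys @ [y] \<in> simplices X (Suc ?m)" using snoc.prems by simp
  have del: "delete_nth (Suc ?m) (xs @ ys @ [y]) = xs @ ys"
    using assms(3) by (simp add: delete_nth_def)
  then have d: "xs @ ys \<in> simplices X ?m"
    using simplicial_subset_E_ssetD(5)[OF X z, of "Suc ?m"] by simp
  have t: "t \<in> standard_simplex ?m"
    using assms(4) standard_simplex_mono[of n ?m] by auto
  then have "simplical_face (Suc ?m) t = t"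
    by (auto simp: simplical_face_def standard_simplex_def fun_eq_iff)
  then show ?case
    using snoc.IH[OF d] realization_class_face[OF X z _ t, of "Suc ?m"] del by simp
qed simp

text \<open>The prepended vertices have weight zero; removing the head is the face with index 0,
  whose coface map shifts all coordinates by one. This identifies the homotopy at time 1.\<close>

lemma realization_class_append_left:
  assumes X: "simplicial_subset X (E_sset A)"
    and "ys @ xs \<in> simplices X (length ys + n)" "length xs = Suc n" "t \<in> standard_simplex n"
  shows "xs \<in> simplices X n \<and> (\<lambda>i. if i < length ys then 0 else t (i - length ys)) \<in> standard_simplex (length ys + n) \<and>
    realization_rel X `` {(length ys + n, ys @ xs, \<lambda>i. if i < length ys then 0 else t (i - length ys))}
      = realization_rel X `` {(n, xs, t)}"
  using assms(2)
proof (induction ys)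
  case (Cons y ys)
  let ?m = "length ys + n" and ?t = "\<lambda>i. if i < length ys then 0 else t (i - length ys)"
  have z: "y # ys @ xs \<in> simplices X (Suc ?m)" using Cons.prems by simp
  have d: "ys @ xs \<in> simplices X ?m"
    using simplicial_subset_E_ssetD(5)[OF X z, of 0] by (simp add: delete_nth_def)
  note IH = Cons.IH[OF d]
  have eq: "simplical_face 0 ?t = (\<lambda>i. if i < length (y # ys) then 0 else t (i - length (y # ys)))"
    by (auto simp: simplical_face_def fun_eq_iff)
  show ?case
    using IH realization_class_face[OF X z, of 0 ?t] simplical_face_in_standard_simplex[of ?t ?m 0]
    unfolding eq by (simp add: delete_nth_def)
qed (use assms in simp)

text \<open>Contiguous simplicial maps are joined by the straight-line homotopy inside the simplices
  \<open>xs @ map \<phi> xs\<close>, so no subdivision of prisms is needed.\<close>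

lemma realization_straight_line_homotopy:
  assumes X: "simplicial_subset X (E_sset A)" and Y: "simplicial_subset Y (E_sset B)"
    and join: "\<And>n xs. xs \<in> simplices X n \<Longrightarrow> xs @ map \<phi> xs \<in> simplices Y (Suc (n + n))"
    and x: "[x] \<in> simplices X 0" "\<phi> x = x"
  obtains K where "continuous_map (prod_topology (top_of_set {0..1::real}) (realization X)) (realization Y) K"
    "\<And>n xs t. xs \<in> simplices X n \<Longrightarrow> t \<in> standard_simplex n \<Longrightarrow>
      K (0, realization_rel X `` {(n, xs, t)}) = realization_rel Y `` {(n, xs, t)}"
    "\<And>n xs t. xs \<in> simplices X n \<Longrightarrow> t \<in> standard_simplex n \<Longrightarrow>
      K (1, realization_rel X `` {(n, xs, t)}) = realization_rel Y `` {(n, map \<phi> xs, t)}"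
    "\<And>s. s \<in> {0..1} \<Longrightarrow> K (s, vertex_point X [x]) = vertex_point Y [x]"
proof -
  let ?h = "\<lambda>s (n, xs, t). realization_rel Y `` {(Suc (n + n), xs @ map \<phi> xs, simplex_join n s t)}"
  note len = simplicial_subset_E_ssetD(3)[OF X]
  obtain K where K: "continuous_map (prod_topology (top_of_set {0..1}) (realization X)) (realization Y) K"
    "\<And>s p. s \<in> {0..1} \<Longrightarrow> p \<in> topspace (simplex_coproduct X) \<Longrightarrow> K (s, realization_rel X `` {p}) = ?h s p"
  proof (rule realization_lift_homotopy[OF X, of "realization Y" ?h])
    fix n
    let ?W = "prod_topology (top_of_set {0..1::real}) (prod_topology
        (discrete_topology (simplices X n)) (subtopology (powertop_real UNIV) (standard_simplex n)))"
    have "continuous_map ?W (discrete_topology (simplices X n)) (\<lambda>w. fst (snd w))"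
      by (intro continuous_map_compose[OF continuous_map_snd, unfolded o_def] continuous_map_fst)
    moreover have "continuous_map (discrete_topology (simplices X n)) (discrete_topology (simplices Y (Suc (n + n))))
        (\<lambda>xs. xs @ map \<phi> xs)"
      using join by auto
    ultimately have "continuous_map ?W (discrete_topology (simplices Y (Suc (n + n))))
        (\<lambda>w. fst (snd w) @ map \<phi> (fst (snd w)))"
      using continuous_map_compose[unfolded o_def] by blast
    then have "continuous_map ?W (prod_topology (discrete_topology (simplices Y (Suc (n + n))))
      (subtopology (powertop_real UNIV) (standard_simplex (Suc (n + n)))))
      (\<lambda>w. (fst (snd w) @ map \<phi> (fst (snd w)), simplex_join n (fst w) (snd (snd w))))"
      by (intro continuous_map_pairedI continuous_map_simplex_join)
    from continuous_map_into_realization[OF this]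
    show "continuous_map ?W (realization Y) (\<lambda>(s, x, t). ?h s (n, x, t))"
      by (simp add: case_prod_unfold)
  next
    fix s :: real and n i xs t
    assume *: "s \<in> {0..1}" "xs \<in> simplices X (Suc n)" "i \<le> Suc n" "t \<in> standard_simplex n"
    then show "?h s (n, delete_nth i xs, t) = ?h s (Suc n, xs, simplical_face i t)"
      using realization_class_join_face[OF Y join[OF *(2)] _ _ *(3,4,1)] len[OF *(2)]
      by (simp add: map_delete_nth)
  next
    fix s :: real and n i xs t
    assume *: "s \<in> {0..1}" "xs \<in> simplices X n" "i \<le> n" "t \<in> standard_simplex (Suc n)"
    then show "?h s (Suc n, double_nth i xs, t) = ?h s (n, xs, simplicial_degen i t)"
      using realization_class_join_degen[OF Y join[OF *(2)] _ _ *(3,4,1)] len[OF *(2)]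
      by (simp add: map_double_nth)
  qed blast
  show ?thesis
  proof (rule that[OF K(1)])
    fix n xs t assume xs: "xs \<in> simplices X n" and t: "t \<in> standard_simplex n"
    note l = len[OF xs]
    have p: "(n, xs, t) \<in> topspace (simplex_coproduct X)"
      using xs t by (simp add: topspace_simplex_coproduct)
    have "simplex_join n 0 t = t"
      using t by (auto simp: simplex_join_def standard_simplex_def fun_eq_iff)
    then show "K (0, realization_rel X `` {(n, xs, t)}) = realization_rel Y `` {(n, xs, t)}"
      using K(2)[OF _ p, of 0] realization_class_append_right[OF Y, of xs "map \<phi> xs" n t] join[OF xs] l t by simp
    have "simplex_join n 1 t = (\<lambda>i. if i < length xs then 0 else t (i - length xs))"
      using l by (auto simp: simplex_join_def fun_eq_iff)
    then show "K (1, realization_rel X `` {(n, xs, t)}) = realization_rel Y `` {(n, map \<phi> xs, t)}"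
      using K(2)[OF _ p, of 1] realization_class_append_left[OF Y, of xs "map \<phi> xs" n t] join[OF xs] l t by simp
  next
    fix s :: real assume s: "s \<in> {0..1}"
    let ?e = "\<lambda>i. if i = 0 then 1 else 0 :: real"
    have e: "?e \<in> standard_simplex 0" by simp
    have "(0, [x], ?e) \<in> topspace (simplex_coproduct X)"
      using x e by (auto simp: topspace_simplex_coproduct)
    \<comment> \<open>Since \<open>\<phi> x = x\<close>, the track of the base vertex lies in the
      degenerate edge \<open>[x, x]\<close>. Collapsing that edge adds the weights 1 - s and s, so
      the base point stays fixed at all times.\<close>
    then have "K (s, vertex_point X [x]) = realization_rel Y `` {(Suc 0, double_nth 0 [x], simplex_join 0 s ?e)}"
      using K(2)[OF s] x by (simp add: vertex_point_def double_nth_def)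
    also have "\<dots> = realization_rel Y `` {(0, [x], simplicial_degen 0 (simplex_join 0 s ?e))}"
    proof (rule realization_class_degen[OF Y])
      show "[x] \<in> simplices Y 0"
        using realization_class_append_right[OF Y _ _ e, of "[x]" "[\<phi> x]"] join[OF x(1)] by simp
      show "simplex_join 0 s ?e \<in> standard_simplex (Suc 0)"
        using simplex_join_in_standard_simplex[OF s e] by simp
    qed simp
    also have "simplicial_degen 0 (simplex_join 0 s ?e) = ?e"
      by (auto simp: simplicial_degen_def simplex_join_def fun_eq_iff)
    finally show "K (s, vertex_point X [x]) = vertex_point Y [x]" by (simp add: vertex_point_def)
  qed
qed

section \<open>Transport of null homotopies\<close>

text \<open>Composition with \<open>\<phi>\<close> preserves based homotopy, so whether the image is
  null homotopic does not depend on the representative. This replaces equalities of homotopy classes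
  by null homotopies of maps.\<close>

lemma homotopy_induced_trivial_iff:
  assumes \<phi>: "continuous_map X Y \<phi>" "\<phi> x = y" and x: "x \<in> topspace X"
  shows "(\<forall>c\<in>homotopy_group k X x. homotopy_induced k Y y \<phi> c = homotopy_unit k Y y) \<longleftrightarrow>
    (\<forall>f\<in>based_maps k X x. homotopic_with (\<lambda>h. h sphere_base = y) (nsphere k) Y (\<phi> \<circ> f) (\<lambda>_. y))"
    (is "?L \<longleftrightarrow> ?R")
proof -
  let ?hX = "homotopic_with (\<lambda>h. h sphere_base = x) (nsphere k) X"
  let ?hY = "homotopic_with (\<lambda>h. h sphere_base = y) (nsphere k) Y"
  have comp: "?hY (\<phi> \<circ> f) (\<phi> \<circ> g)" if "?hX f g" for f g
    by (rule homotopic_with_compose_continuous_map_left[OF that \<phi>(1)]) (simp add: \<phi>(2))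
  have refl: "?hX f f" if "f \<in> based_maps k X x" for f
    using that by (simp add: based_maps_def)
  have const: "?hY (\<lambda>_. y) (\<lambda>_. y)"
    using \<phi> x by (auto simp: continuous_map_def)
  have "homotopy_induced k Y y \<phi> (based_homotopy k X x `` {f}) = homotopy_unit k Y y
      \<longleftrightarrow> ?hY (\<phi> \<circ> f) (\<lambda>_. y)" if f: "f \<in> based_maps k X x" for f
  proof
    assume "homotopy_induced k Y y \<phi> (based_homotopy k X x `` {f}) = homotopy_unit k Y y"
    \<comment> \<open>The constant map lies in the unit class, so it is homotopic to the image of
      some representative \<open>g\<close>.\<close>
    then have "(\<lambda>_. y) \<in> homotopy_induced k Y y \<phi> (based_homotopy k X x `` {f})"
      using const by (simp add: homotopy_unit_def based_homotopy_def)
    then obtain g where "?hX f g" "?hY (\<phi> \<circ> g) (\<lambda>_. y)"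
      by (auto simp: homotopy_induced_def based_homotopy_def)
    then show "?hY (\<phi> \<circ> f) (\<lambda>_. y)"
      using comp homotopic_with_trans by blast
  next
    assume *: "?hY (\<phi> \<circ> f) (\<lambda>_. y)"
    \<comment> \<open>All representatives have images in the class of the constant map, so the union
      over them in \<open>homotopy_induced\<close> is just that class.\<close>
    have "?hY (\<phi> \<circ> g) e \<longleftrightarrow> ?hY (\<lambda>_. y) e" if "?hX f g" for g e
      using comp[OF that] * homotopic_with_trans homotopic_with_symD by blast
    moreover have "homotopy_induced k Y y \<phi> (based_homotopy k X x `` {f}) = {e. \<exists>g. ?hX f g \<and> ?hY (\<phi> \<circ> g) e}"
      "homotopy_unit k Y y = {e. ?hY (\<lambda>_. y) e}"
      by (auto simp: homotopy_induced_def homotopy_unit_def based_homotopy_def)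
    ultimately show "homotopy_induced k Y y \<phi> (based_homotopy k X x `` {f}) = homotopy_unit k Y y"
      using refl[OF f] by blast
  qed
  then show ?thesis
    unfolding homotopy_group_def quotient_def by auto
qed

section \<open>Inclusions of simplicial subsets on realizations\<close>

lemma realization_point:
  assumes "z \<in> topspace (realization X)"
  obtains n xs t where "xs \<in> simplices X n" "t \<in> standard_simplex n"
    "z = realization_rel X `` {(n, xs, t)}"
proof -
  obtain p where "p \<in> topspace (simplex_coproduct X)" "z = realization_rel X `` {p}"
    using assms unfolding topspace_realization by (rule quotientE)
  then show ?thesis using that by (auto simp: topspace_simplex_coproduct)
qed

lemma vertex_point_in_realization:
  assumes "x \<in> simplices X 0"
  shows "vertex_point X x \<in> topspace (realization X)"
proof -
  have "(0, x, \<lambda>i. if i = 0 then 1 else 0 :: real) \<in> topspace (simplex_coproduct X)"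
    using assms by (auto simp: topspace_simplex_coproduct)
  then show ?thesis
    unfolding topspace_realization vertex_point_def by (rule quotientI)
qed

text \<open>The relation of \<open>X\<close> is contained in that of \<open>Y\<close>. By
  transitivity, the relational image of a whole \<open>X\<close>-class is the single
  \<open>Y\<close>-class of any of its representatives.\<close>

lemma realization_incl_class:
  assumes X: "simplicial_subset X (E_sset A)" and Y: "simplicial_subset Y (E_sset B)"
    and XY: "\<And>n. simplices X n \<subseteq> simplices Y n"
    and xs: "xs \<in> simplices X n" and t: "t \<in> standard_simplex n"
  shows "realization_incl Y (realization_rel X `` {(n, xs, t)}) = realization_rel Y `` {(n, xs, t)}"
proof -
  let ?p = "(n, xs, t)"
  have "realization_glue X \<subseteq> realization_glue Y"
    unfolding realization_glue_def simplicial_subset_E_ssetD(1,2)[OF X] simplicial_subset_E_ssetD(1,2)[OF Y]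
    using XY by blast
  moreover have "topspace (simplex_coproduct X) \<subseteq> topspace (simplex_coproduct Y)"
    using XY by (auto simp: topspace_simplex_coproduct)
  ultimately have sub: "realization_rel X \<subseteq> realization_rel Y"
    unfolding realization_rel_def by (intro Int_mono rtrancl_mono Sigma_mono) auto
  have "(?p, ?p) \<in> realization_rel X"
    using xs t equiv_realization_rel[of X] by (auto simp: equiv_def refl_on_def topspace_simplex_coproduct)
  moreover have "trans (realization_rel Y)"
    using equiv_realization_rel[of Y] by (auto simp: equiv_def)
  ultimately show ?thesis
    unfolding realization_incl_def using sub by (auto dest: transD)
qed

lemma realization_incl_vertex_point:
  assumes "simplicial_subset X (E_sset A)" "simplicial_subset Y (E_sset B)"
    and "\<And>n. simplices X n \<subseteq> simplices Y n" "x \<in> simplices X 0"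
  shows "realization_incl Y (vertex_point X x) = vertex_point Y x"
  unfolding vertex_point_def by (rule realization_incl_class[OF assms]) auto

text \<open>On points of the realization, \<open>realization_incl\<close> agrees with the continuous
  map induced by the identity on vertices.\<close>

lemma continuous_map_realization_incl:
  assumes X: "simplicial_subset X (E_sset A)" and Y: "simplicial_subset Y (E_sset B)"
    and XY: "\<And>n. simplices X n \<subseteq> simplices Y n"
  shows "continuous_map (realization X) (realization Y) (realization_incl Y)"
proof -
  obtain F where F: "continuous_map (realization X) (realization Y) F"
    "\<And>n xs t. xs \<in> simplices X n \<Longrightarrow> t \<in> standard_simplex n \<Longrightarrow>
      F (realization_rel X `` {(n, xs, t)}) = realization_rel Y `` {(n, map id xs, t)}"
  proof (rule realization_map[OF X Y])
    show "map id xs \<in> simplices Y n" if "xs \<in> simplices X n" for n xs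
      using that XY by auto
  qed blast
  have "F z = realization_incl Y z" if "z \<in> topspace (realization X)" for z
    using that by (rule realization_point) (simp add: F(2) realization_incl_class[OF X Y XY])
  with F(1) show ?thesis by (rule continuous_map_eq)
qed

text \<open>The innermost condition of \<open>essentially_connected\<close>, isolated so that it can
  be carried from one pair of stages to another.\<close>

definition inclusion_trivial :: "nat \<Rightarrow> 's sset \<Rightarrow> 's sset \<Rightarrow> 's \<Rightarrow> bool" where
  "inclusion_trivial k X Y x \<longleftrightarrow>
     (\<forall>c\<in>homotopy_group k (realization X) (vertex_point X x).
        homotopy_induced k (realization Y) (vertex_point Y x) (realization_incl Y) c
          = homotopy_unit k (realization Y) (vertex_point Y x))"

lemma inclusion_trivial_iff:
  assumes X: "simplicial_subset X (E_sset A)" and Y: "simplicial_subset Y (E_sset B)"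
    and XY: "\<And>n. simplices X n \<subseteq> simplices Y n" and x: "x \<in> simplices X 0"
  shows "inclusion_trivial k X Y x \<longleftrightarrow>
    (\<forall>f\<in>based_maps k (realization X) (vertex_point X x).
      homotopic_with (\<lambda>h. h sphere_base = vertex_point Y x) (nsphere k) (realization Y)
        (realization_incl Y \<circ> f) (\<lambda>_. vertex_point Y x))"
  unfolding inclusion_trivial_def
  by (intro homotopy_induced_trivial_iff continuous_map_realization_incl[OF X Y XY]
      realization_incl_vertex_point[OF X Y XY x] vertex_point_in_realization x)

text \<open>The composite of the maps from \<open>X\<close> to \<open>Y\<close>, \<open>Y'\<close>
  and \<open>X'\<close> kills based spheres because its middle part does. By \<open>join\<close>,
  this composite is contiguous to the inclusion of \<open>X\<close> in \<open>X'\<close>, and the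
  resulting homotopy fixes the base vertex, so the inclusion kills them too.\<close>

lemma inclusion_trivial_transfer:
  assumes X: "simplicial_subset X (E_sset A)" and X': "simplicial_subset X' (E_sset A)"
    and Y: "simplicial_subset Y (E_sset B)" and Y': "simplicial_subset Y' (E_sset B)"
    and \<phi>: "\<And>n xs. xs \<in> simplices X n \<Longrightarrow> map \<phi> xs \<in> simplices Y n"
    and \<psi>: "\<And>n ys. ys \<in> simplices Y' n \<Longrightarrow> map \<psi> ys \<in> simplices X' n"
    and YY': "\<And>n. simplices Y n \<subseteq> simplices Y' n"
    and join: "\<And>n xs. xs \<in> simplices X n \<Longrightarrow> xs @ map (\<psi> \<circ> \<phi>) xs \<in> simplices X' (Suc (n + n))"
    and x: "[x] \<in> simplices X 0" "\<psi> (\<phi> x) = x"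
    and triv: "inclusion_trivial k Y Y' [\<phi> x]"
  shows "inclusion_trivial k X X' [x]"
proof -
  \<comment> \<open>Containment is a consequence of \<open>join\<close>: \<open>xs\<close> is an
    iterated face of \<open>xs @ map (\<psi> \<circ> \<phi>) xs\<close>.\<close>
  have XX': "simplices X n \<subseteq> simplices X' n" for n
  proof
    fix xs assume xs: "xs \<in> simplices X n"
    from realization_class_append_right[OF X', of xs "map (\<psi> \<circ> \<phi>) xs" n "\<lambda>i. if i = 0 then 1 else 0"]
    show "xs \<in> simplices X' n"
      using simplicial_subset_E_ssetD(3)[OF X xs] join[OF xs] by simp
  qed
  obtain F where F: "continuous_map (realization X) (realization Y) F"
    "\<And>n xs t. xs \<in> simplices X n \<Longrightarrow> t \<in> standard_simplex n \<Longrightarrow>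
      F (realization_rel X `` {(n, xs, t)}) = realization_rel Y `` {(n, map \<phi> xs, t)}"
    by (rule realization_map[OF X Y \<phi>]) blast+
  obtain P where P: "continuous_map (realization Y') (realization X') P"
    "\<And>n ys t. ys \<in> simplices Y' n \<Longrightarrow> t \<in> standard_simplex n \<Longrightarrow>
      P (realization_rel Y' `` {(n, ys, t)}) = realization_rel X' `` {(n, map \<psi> ys, t)}"
    by (rule realization_map[OF Y' X' \<psi>]) blast+
  obtain K where K: "continuous_map (prod_topology (top_of_set {0..1::real}) (realization X)) (realization X') K"
    "\<And>n xs t. xs \<in> simplices X n \<Longrightarrow> t \<in> standard_simplex n \<Longrightarrow>
      K (0, realization_rel X `` {(n, xs, t)}) = realization_rel X' `` {(n, xs, t)}"
    "\<And>n xs t. xs \<in> simplices X n \<Longrightarrow> t \<in> standard_simplex n \<Longrightarrow>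
      K (1, realization_rel X `` {(n, xs, t)}) = realization_rel X' `` {(n, map (\<psi> \<circ> \<phi>) xs, t)}"
    "\<And>s. s \<in> {0..1} \<Longrightarrow> K (s, vertex_point X [x]) = vertex_point X' [x]"
  proof (rule realization_straight_line_homotopy[OF X X' join x(1)])
    show "(\<psi> \<circ> \<phi>) x = x" using x(2) by simp
  qed blast+
  have K0: "K (0, z) = realization_incl X' z" if "z \<in> topspace (realization X)" for z
    using that by (rule realization_point) (simp add: K(2) realization_incl_class[OF X X' XX'])
  have K1: "K (1, z) = P (realization_incl Y' (F z))" if "z \<in> topspace (realization X)" for z
    using that
  proof (rule realization_point)
    fix n xs t assume "xs \<in> simplices X n" "t \<in> standard_simplex n" "z = realization_rel X `` {(n, xs, t)}"
    then show ?thesis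
      using realization_incl_class[OF Y Y' YY' \<phi>, of xs n t] \<phi>[of xs n] YY'[of n]
      by (simp add: K(3) F(2) P(2) subset_iff)
  qed
  have \<phi>x: "[\<phi> x] \<in> simplices Y 0"
    using \<phi>[OF x(1)] by simp
  have Fx: "F (vertex_point X [x]) = vertex_point Y [\<phi> x]"
    using F(2)[OF x(1)] by (simp add: vertex_point_def)
  have Px: "P (vertex_point Y' [\<phi> x]) = vertex_point X' [x]"
    using P(2)[OF subsetD[OF YY' \<phi>x]] x(2) by (simp add: vertex_point_def)
  have ix: "realization_incl Y' (vertex_point Y [\<phi> x]) = vertex_point Y' [\<phi> x]"
    by (rule realization_incl_vertex_point[OF Y Y' YY' \<phi>x])
  show ?thesis
    unfolding inclusion_trivial_iff[OF X X' XX' x(1)]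
  proof
    fix f assume f: "f \<in> based_maps k (realization X) (vertex_point X [x])"
    let ?h = "homotopic_with (\<lambda>h. h sphere_base = vertex_point X' [x]) (nsphere k) (realization X')"
    have fc: "continuous_map (nsphere k) (realization X) f" and fx: "f sphere_base = vertex_point X [x]"
      using f by (auto simp: based_maps_def)
    have fz: "f z \<in> topspace (realization X)" if "z \<in> topspace (nsphere k)" for z
      using fc that by (auto simp: continuous_map_def)
    have "F \<circ> f \<in> based_maps k (realization Y) (vertex_point Y [\<phi> x])"
      using continuous_map_compose[OF fc F(1)] fx Fx by (simp add: based_maps_def)
    then have "homotopic_with (\<lambda>h. h sphere_base = vertex_point Y' [\<phi> x]) (nsphere k) (realization Y')
        (realization_incl Y' \<circ> (F \<circ> f)) (\<lambda>_. vertex_point Y' [\<phi> x])"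
      using triv unfolding inclusion_trivial_iff[OF Y Y' YY' \<phi>x] by blast
    then have "?h (P \<circ> (realization_incl Y' \<circ> (F \<circ> f))) (P \<circ> (\<lambda>_. vertex_point Y' [\<phi> x]))"
      by (rule homotopic_with_compose_continuous_map_left[OF _ P(1)]) (simp add: Px)
    then have null: "?h (P \<circ> (realization_incl Y' \<circ> (F \<circ> f))) (\<lambda>_. vertex_point X' [x])"
      by (simp add: o_def Px)
    have Kf: "?h (\<lambda>z. K (0, f z)) (\<lambda>z. K (1, f z))"
      unfolding homotopic_with_def
    proof (intro exI conjI allI ballI)
      let ?W = "prod_topology (top_of_set {0..1::real}) (nsphere k)"
      have "continuous_map ?W (prod_topology (top_of_set {0..1}) (realization X)) (\<lambda>w. (fst w, f (snd w)))"
        by (intro continuous_map_pairedI continuous_map_fst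
            continuous_map_compose[OF continuous_map_snd fc, unfolded o_def])
      from continuous_map_compose[OF this K(1)]
      show "continuous_map ?W (realization X') (\<lambda>w. K (fst w, f (snd w)))" by (simp add: o_def)
    qed (auto simp: fx K(4))
    \<comment> \<open>The ends of \<open>K\<close> are known only on points of the realization. As
      \<open>f\<close> maps the sphere there, agreement on the sphere together with the base point
      condition gives the homotopy.\<close>
    have "?h (\<lambda>z. K (0, f z)) (realization_incl X' \<circ> f)"
      using homotopic_with_imp_continuous_maps[OF Kf] K0[OF fz] fx K(4)[of 0]
        realization_incl_vertex_point[OF X X' XX' x(1)]
      by (intro homotopic_with_equal) auto
    moreover have "?h (\<lambda>z. K (1, f z)) (P \<circ> (realization_incl Y' \<circ> (F \<circ> f)))"
      using homotopic_with_imp_continuous_maps[OF Kf] K1[OF fz] fx K(4)[of 1] Fx ix Px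
      by (intro homotopic_with_equal) auto
    ultimately show "?h (realization_incl X' \<circ> f) (\<lambda>_. vertex_point X' [x])"
      using Kf null homotopic_with_trans homotopic_with_symD by blast
  qed
qed

section \<open>Compact sets and the retraction onto a cocompact subgroup\<close>

text \<open>A list over the translate of \<open>C\<close> by \<open>g\<close> is the translate of a
  list over \<open>C\<close>. In this form membership depends only on the length and the set of
  entries, which makes concatenations easy to handle.\<close>

lemma simplices_half_translates:
  "ys \<in> simplices (half_translates G chi C) n \<longleftrightarrow>
     length ys = Suc n \<and> (\<exists>g\<in>half_group G chi. set ys \<subseteq> (\<lambda>x. g \<otimes>\<^bsub>G\<^esub> x) ` C)"
proof -
  have *: "(\<exists>xs. ys = map f xs \<and> length xs = Suc n \<and> set xs \<subseteq> C) \<longleftrightarrow> length ys = Suc n \<and> set ys \<subseteq> f ` C"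
    for f :: "'a \<Rightarrow> 'a"
    using lists_image[of f C] by (auto simp: lists_eq_set image_iff set_eq_iff)
  have "ys \<in> simplices (half_translates G chi C) n \<longleftrightarrow> (\<exists>g\<in>half_group G chi.
      \<exists>xs. ys = map (\<lambda>x. g \<otimes>\<^bsub>G\<^esub> x) xs \<and> length xs = Suc n \<and> set xs \<subseteq> C)"
    by (auto simp: half_translates_def E_sset_def)
  then show ?thesis
    unfolding * by blast
qed

lemma half_translates_mono:
  "C \<subseteq> D \<Longrightarrow> simplices (half_translates G chi C) n \<subseteq> simplices (half_translates G chi D) n"
  by (auto simp: simplices_half_translates) blast

lemma (in group) character_inv:
  assumes "character G T chi" "g \<in> carrier G"
  shows "chi (inv g) = - chi g"
proof -
  have mult: "chi (x \<otimes> y) = chi x + chi y" if "x \<in> carrier G" "y \<in> carrier G" for x y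
    using assms(1) that by (simp add: character_def)
  have "chi \<one> = 0"
    using mult[of \<one> \<one>] by simp
  then show ?thesis
    using mult[of g "inv g"] assms(2) by simp
qed

section \<open>Stages of the filtration and change of base vertex\<close>

text \<open>Fixing the vertex \<open>x\<close>, which \<open>essentially_connected\<close>
  quantifies existentially, lets base vertices be compared.\<close>

definition half_connected_at ::
    "int \<Rightarrow> ('a, 'b) monoid_scheme \<Rightarrow> 'a topology \<Rightarrow> ('a \<Rightarrow> real) \<Rightarrow> 'a \<Rightarrow> bool" where
  "half_connected_at m G T chi x \<longleftrightarrow>
     (\<forall>k C. int k \<le> m \<longrightarrow> compactin T C \<longrightarrow> [x] \<in> simplices (half_translates G chi C) 0 \<longrightarrow>
        (\<exists>D. compactin T D \<and> C \<subseteq> D \<and>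
          inclusion_trivial k (half_translates G chi C) (half_translates G chi D) [x]))"

context topological_group
begin

lemma compactin_carrier: "compactin T C \<Longrightarrow> C \<subseteq> carrier G"
  using compactin_subset_topspace[of T C] by (simp add: topspace_eq_carrier)

lemma compactin_set_mult:
  assumes "compactin T A" "compactin T B"
  shows "compactin T (A <#> B)"
proof -
  have "A <#> B = (\<lambda>(x, y). x \<otimes> y) ` (A \<times> B)"
    by (auto simp: set_mult_def)
  then show ?thesis
    using image_compactin[OF _ continuous_mult] assms by (simp add: compactin_Times)
qed

lemma compactin_set_inv: "compactin T A \<Longrightarrow> compactin T (m_inv G ` A)"
  by (rule image_compactin[OF _ continuous_inv])

lemma compactin_singleton: "x \<in> carrier G \<Longrightarrow> compactin T {x}"
  by (simp add: topspace_eq_carrier)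

lemma simplicial_subset_half_translates:
  assumes "character G T chi" "compactin T C"
  shows "simplicial_subset (half_translates G chi C) (E_sset (carrier G))"
  using filtration_half_translates[OF assms(1)] assms(2) by (simp add: filtration_def)

text \<open>From a(hc) = (a h a^-1)(ac) and invariance of \<open>chi\<close> under conjugation, left
  translation by \<open>a\<close> carries the stage of \<open>C\<close> onto that of aC. A
  translation taking \<open>y\<close> to \<open>x\<close> thus transports triviality back to
  \<open>y\<close>.\<close>

lemma half_connected_at_translate:
  assumes chi: "character G T chi" and x: "half_connected_at m G T chi x" "x \<in> carrier G" and y: "y \<in> carrier G"
  shows "half_connected_at m G T chi y"
  unfolding half_connected_at_def
proof (intro allI impI)
  fix k C
  assume k: "int k \<le> m" and C: "compactin T C" and yC: "[y] \<in> simplices (half_translates G chi C) 0"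
  note CG = compactin_carrier[OF C]
  define g where "g = x \<otimes> inv y"
  have g: "g \<in> carrier G" using x y by (simp add: g_def)
  have gy: "g \<otimes> y = x" using x y by (simp add: g_def m_assoc)
  have mult: "chi (a \<otimes> b) = chi a + chi b" if "a \<in> carrier G" "b \<in> carrier G" for a b
    using chi that by (simp add: character_def)
  have translate: "map (\<lambda>z. a \<otimes> z) zs \<in> simplices (half_translates G chi ({a} <#> B)) n"
    if a: "a \<in> carrier G" and B: "B \<subseteq> carrier G" and zs: "zs \<in> simplices (half_translates G chi B) n" for a B zs n
  proof -
    obtain h where h: "h \<in> half_group G chi" "set zs \<subseteq> (\<lambda>x. h \<otimes> x) ` B" and len: "length zs = Suc n"
      using zs by (auto simp: simplices_half_translates)
    have hG: "h \<in> carrier G" using h by (simp add: half_group_def)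
    have "a \<otimes> h \<otimes> inv a \<in> half_group G chi"
      using a hG h(1) by (simp add: half_group_def mult character_inv[OF chi])
    moreover have "a \<otimes> (h \<otimes> b) = a \<otimes> h \<otimes> inv a \<otimes> (a \<otimes> b)" if "b \<in> B" for b
    proof -
      have b: "b \<in> carrier G" using that B by blast
      have "inv a \<otimes> (a \<otimes> b) = b"
        using a b by (simp add: m_assoc[symmetric])
      then show ?thesis using a hG b by (simp add: m_assoc)
    qed
    then have "(\<lambda>z. a \<otimes> z) ` set zs \<subseteq> (\<lambda>x. a \<otimes> h \<otimes> inv a \<otimes> x) ` ({a} <#> B)"
      using h(2) by (fastforce simp: set_mult_def)
    ultimately show ?thesis
      using len unfolding simplices_half_translates by auto
  qed
  have gC: "compactin T ({g} <#> C)"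
    by (intro compactin_set_mult compactin_singleton g C)
  have "[x] \<in> simplices (half_translates G chi ({g} <#> C)) 0"
    using translate[OF g CG yC] gy by simp
  then obtain D where D: "compactin T D" "{g} <#> C \<subseteq> D"
    and triv: "inclusion_trivial k (half_translates G chi ({g} <#> C)) (half_translates G chi D) [x]"
    using x(1) k gC unfolding half_connected_at_def by blast
  \<comment> \<open>The second set receives the translate back of the stage of \<open>D\<close>; the
    first makes the inclusion of \<open>C\<close> immediate.\<close>
  let ?C' = "C \<union> ({inv g} <#> D)"
  have C': "compactin T ?C'"
    by (intro compactin_Un compactin_set_mult compactin_singleton inv_closed g C D)
  have "inclusion_trivial k (half_translates G chi C) (half_translates G chi ?C') [y]"
  proof (rule inclusion_trivial_transfer)
    show "map (\<lambda>z. g \<otimes> z) xs \<in> simplices (half_translates G chi ({g} <#> C)) n"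
      if "xs \<in> simplices (half_translates G chi C) n" for n xs
      by (rule translate[OF g CG that])
    show "map (\<lambda>z. inv g \<otimes> z) ys \<in> simplices (half_translates G chi ?C') n"
      if "ys \<in> simplices (half_translates G chi D) n" for n ys
      using translate[OF inv_closed[OF g] compactin_carrier[OF D(1)] that]
        half_translates_mono[of "{inv g} <#> D" ?C' G chi n] by blast
    show "simplices (half_translates G chi ({g} <#> C)) n \<subseteq> simplices (half_translates G chi D) n" for n
      by (rule half_translates_mono[OF D(2)])
    show "inv g \<otimes> (g \<otimes> y) = y"
      using g y by (simp add: m_assoc[symmetric])
    show "inclusion_trivial k (half_translates G chi ({g} <#> C)) (half_translates G chi D) [g \<otimes> y]"
      using triv gy by simp
    show "xs @ map ((\<lambda>z. inv g \<otimes> z) \<circ> (\<lambda>z. g \<otimes> z)) xs \<in> simplices (half_translates G chi ?C') (Suc (n + n))"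
      if xs: "xs \<in> simplices (half_translates G chi C) n" for n xs
    proof -
      have "set xs \<subseteq> carrier G"
        using simplicial_subset_E_ssetD(4)[OF simplicial_subset_half_translates[OF chi C] xs] .
      \<comment> \<open>Translating forth and back is the identity, so the join is
        \<open>xs @ xs\<close> and has no new entries.\<close>
      then have "map ((\<lambda>z. inv g \<otimes> z) \<circ> (\<lambda>z. g \<otimes> z)) xs = xs"
        using g by (intro map_idI) (auto simp: m_assoc[symmetric])
      then show ?thesis
        using xs unfolding simplices_half_translates by auto
    qed
  qed (use simplicial_subset_half_translates[OF chi] C gC D(1) C' yC in auto)
  then show "\<exists>D. compactin T D \<and> C \<subseteq> D \<and>
      inclusion_trivial k (half_translates G chi C) (half_translates G chi D) [y]"
    using C' by blast
qed

lemma Sigma_top_iff: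
  assumes chi: "character G T chi"
  shows "chi \<in> Sigma_top n G T \<longleftrightarrow> half_connected_at (int n - 1) G T chi \<one>"
proof -
  have "simplices (E_sset (carrier G)) 0 = {[x] | x. x \<in> carrier G}"
    by (auto simp: E_sset_def length_Suc_conv)
  then have "chi \<in> Sigma_top n G T \<longleftrightarrow> (\<exists>x\<in>carrier G. half_connected_at (int n - 1) G T chi x)"
    unfolding Sigma_top_def essentially_connected_def half_connected_at_def inclusion_trivial_def
    using chi by auto
  then show ?thesis
    using half_connected_at_translate[OF chi] one_closed by blast
qed

section \<open>The bounded retraction onto a cocompact subgroup\<close>

text \<open>A set-theoretic choice of \<open>r\<close> suffices, as it acts only on vertices.
  Writing g = r(g) b gives chi(r g) = chi g - chi b, and \<open>chi\<close> is bounded on the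
  compact set \<open>B\<close>. The loss is thus bounded, and \<open>s\<close> is chosen to
  compensate for it.\<close>

lemma cocompact_retraction:
  assumes H: "subgroup H G" and coco: "cocompact G T H" and chi: "character G T chi"
  obtains B r s where "compactin T B" "\<And>g. g \<in> carrier G \<Longrightarrow> r g \<in> H" "\<And>h. h \<in> H \<Longrightarrow> r h = h"
    "\<And>g. g \<in> carrier G \<Longrightarrow> \<exists>b\<in>B. g = r g \<otimes> b"
    "s \<in> H" "\<And>g. g \<in> half_group G chi \<Longrightarrow> r g \<otimes> s \<in> half_group G chi"
proof -
  have HG: "H \<subseteq> carrier G" using H by (rule subgroup.subset)
  have mult: "chi (a \<otimes> b) = chi a + chi b" if "a \<in> carrier G" "b \<in> carrier G" for a b
    using chi that by (simp add: character_def)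
  obtain B0 where B0: "compactin T B0" "H <#> B0 = carrier G"
    using coco by (auto simp: cocompact_def)
  \<comment> \<open>Adjoining the unit allows h = h 1, so that \<open>r\<close> can be the identity
    on \<open>H\<close>.\<close>
  define B where "B = insert \<one> B0"
  have B: "compactin T B"
    using compactin_Un[OF compactin_singleton[OF one_closed] B0(1)] by (simp add: B_def)
  define r where "r g = (if g \<in> H then g else SOME h. h \<in> H \<and> (\<exists>b\<in>B. g = h \<otimes> b))" for g
  have r: "r g \<in> H \<and> (\<exists>b\<in>B. g = r g \<otimes> b)" if g: "g \<in> carrier G" for g
  proof (cases "g \<in> H")
    case True
    then show ?thesis using g by (auto simp: r_def B_def)
  next
    case False
    have "\<exists>h. h \<in> H \<and> (\<exists>b\<in>B. g = h \<otimes> b)"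
      using g unfolding B0(2)[symmetric] by (auto simp: set_mult_def B_def)
    from someI_ex[OF this] False show ?thesis by (simp add: r_def)
  qed
  have "compact (chi ` B)"
    using image_compactin[OF B, of euclideanreal chi] chi by (simp add: character_def)
  then obtain M where M: "\<And>b. b \<in> B \<Longrightarrow> chi b \<le> M"
    using bounded_imp_bdd_above[OF compact_imp_bounded, of "chi ` B"] by (auto simp: bdd_above_def)
  have "\<exists>s\<in>H. \<forall>g\<in>half_group G chi. 0 \<le> chi (r g) + chi s"
  proof (cases "\<forall>h\<in>H. chi h = 0")
    \<comment> \<open>If \<open>chi\<close> vanishes on \<open>H\<close>, then chi(r g) = 0 and the
      unit serves as \<open>s\<close>.\<close>
    case True
    then show ?thesis
      using r subgroup.one_closed[OF H] by (auto simp: half_group_def intro!: bexI[of _ \<one>])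
  next
    case False
    then obtain h where h: "h \<in> H" "chi h \<noteq> 0" by blast
    have "\<exists>h\<in>H. 0 < chi h"
    proof (cases "0 < chi h")
      case False
      then have "0 < chi (inv h)"
        using h HG character_inv[OF chi, of h] by auto
      then show ?thesis using subgroup.m_inv_closed[OF H h(1)] by blast
    qed (use h in blast)
    then obtain h where h: "h \<in> H" "0 < chi h" by blast
    \<comment> \<open>A high enough power of an element of positive value outweighs the bound
      \<open>M\<close>; this power becomes \<open>s\<close>.\<close>
    obtain p :: nat where p: "M < real p * chi h"
      using reals_Archimedean3[OF h(2)] by blast
    have pow: "h [^] q \<in> H \<and> chi (h [^] q) = real q * chi h" for q :: nat
    proof (induction q)
      case 0
      have "chi \<one> = 0" using mult[of \<one> \<one>] by simp
      then show ?case using subgroup.one_closed[OF H] by simp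
    next
      case (Suc q)
      then show ?case
        using h HG subgroup.m_closed[OF H] by (auto simp: mult algebra_simps)
    qed
    have "0 \<le> chi (r g) + chi (h [^] p)" if "g \<in> half_group G chi" for g
    proof -
      have g: "g \<in> carrier G" "0 \<le> chi g" using that by (auto simp: half_group_def)
      then obtain b where b: "b \<in> B" "g = r g \<otimes> b" using r by blast
      have "chi g = chi (r g) + chi b"
        using mult[of "r g" b] b r[OF g(1)] HG compactin_carrier[OF B] by auto
      then show ?thesis using M[OF b(1)] g(2) pow[of p] p by linarith
    qed
    then show ?thesis using pow by blast
  qed
  then obtain s where s: "s \<in> H" "\<And>g. g \<in> half_group G chi \<Longrightarrow> 0 \<le> chi (r g) + chi s"
    by blast
  show ?thesis
  proof (rule that[OF B, of r s])
    fix g assume g: "g \<in> half_group G chi"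
    then have "r g \<in> carrier G" using r HG by (auto simp: half_group_def)
    then show "r g \<otimes> s \<in> half_group G chi"
      using s(2)[OF g] s(1) HG by (auto simp: half_group_def mult)
  qed (use r s in \<open>auto simp: r_def\<close>)
qed

end

section \<open>Comparison of the filtrations for the group and the subgroup\<close>

lemma character_restrict:
  assumes "subgroup H G" "character G T chi"
  shows "character (G\<lparr>carrier := H\<rparr>) (subtopology T H) (restrict chi H)"
proof -
  have "continuous_map (subtopology T H) euclideanreal chi"
    using assms(2) by (simp add: character_def continuous_map_from_subtopology)
  then have "continuous_map (subtopology T H) euclideanreal (restrict chi H)"
    by (rule continuous_map_eq) simp
  then show ?thesis
    using assms subgroup.m_closed[OF assms(1)] subgroup.mem_carrier[OF assms(1)]
    by (simp add: character_def)
qed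

theorem theorem6:
  fixes G :: "('a, 'b) monoid_scheme" and T :: "'a topology"
    and H :: "'a set" and n :: nat and chi :: "'a \<Rightarrow> real"
  assumes "lc_hausdorff_group G T"
    and "subgroup H G" and "closedin T H" and "cocompact G T H"
    and "character G T chi"
  shows "chi \<in> Sigma_top n G T \<longleftrightarrow>
    restrict chi H \<in> Sigma_top n (G\<lparr>carrier := H\<rparr>) (subtopology T H)"
proof -
  note H = assms(2) and chi = assms(5)
  interpret G: lc_hausdorff_group G T by (rule assms(1))
  interpret K: lc_hausdorff_group "G\<lparr>carrier := H\<rparr>" "subtopology T H"
    by (rule G.closed_subgroup[OF assms(2,3)])
  note chiH = character_restrict[OF H chi]
  have HG: "H \<subseteq> carrier G" using H by (rule subgroup.subset)
  let ?F = "half_translates G chi" and ?E = "half_translates (G\<lparr>carrier := H\<rparr>) (restrict chi H)"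
  obtain B r s where B: "compactin T B" and r: "\<And>g. g \<in> carrier G \<Longrightarrow> r g \<in> H" "\<And>h. h \<in> H \<Longrightarrow> r h = h"
    "\<And>g. g \<in> carrier G \<Longrightarrow> \<exists>b\<in>B. g = r g \<otimes>\<^bsub>G\<^esub> b"
    and s: "s \<in> H" "\<And>g. g \<in> half_group G chi \<Longrightarrow> r g \<otimes>\<^bsub>G\<^esub> s \<in> half_group G chi"
    by (rule G.cocompact_retraction[OF H assms(4) chi]) blast
  note BG = G.compactin_carrier[OF B]
  have half: "half_group (G\<lparr>carrier := H\<rparr>) (restrict chi H) = H \<inter> half_group G chi"
    using HG by (auto simp: half_group_def)
  have one: "r \<one>\<^bsub>G\<^esub> = \<one>\<^bsub>G\<^esub>" using r(2) subgroup.one_closed[OF H] .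
  \<comment> \<open>Solving gx = r(gx) b for r(gx) shows that \<open>r\<close> moves points of gC
    only into g C B^-1, with the same translating element \<open>g\<close>.\<close>
  have r_eq: "\<exists>b\<in>B. r (g \<otimes>\<^bsub>G\<^esub> x) = g \<otimes>\<^bsub>G\<^esub> (x \<otimes>\<^bsub>G\<^esub> inv\<^bsub>G\<^esub> b)"
    if g: "g \<in> carrier G" and x: "x \<in> carrier G" for g x
  proof -
    have gx: "g \<otimes>\<^bsub>G\<^esub> x \<in> carrier G" using g x by simp
    obtain b where b: "b \<in> B" "g \<otimes>\<^bsub>G\<^esub> x = r (g \<otimes>\<^bsub>G\<^esub> x) \<otimes>\<^bsub>G\<^esub> b"
      using r(3)[OF gx] by blast
    have "r (g \<otimes>\<^bsub>G\<^esub> x) = g \<otimes>\<^bsub>G\<^esub> x \<otimes>\<^bsub>G\<^esub> inv\<^bsub>G\<^esub> b"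
      using b BG r(1)[OF gx] HG gx by (metis G.inv_solve_right subsetD)
    moreover have "g \<otimes>\<^bsub>G\<^esub> x \<otimes>\<^bsub>G\<^esub> inv\<^bsub>G\<^esub> b = g \<otimes>\<^bsub>G\<^esub> (x \<otimes>\<^bsub>G\<^esub> inv\<^bsub>G\<^esub> b)"
      using b(1) BG g x by (intro G.m_assoc) auto
    ultimately show ?thesis using b(1) by auto
  qed
  have incl: "simplices (?E C) m \<subseteq> simplices (?F D) m" if "C \<subseteq> D" for C D m
  proof
    fix xs assume "xs \<in> simplices (?E C) m"
    then obtain g where "g \<in> half_group G chi" "set xs \<subseteq> (\<lambda>x. g \<otimes>\<^bsub>G\<^esub> x) ` C" "length xs = Suc m"
      unfolding simplices_half_translates half by auto
    then show "xs \<in> simplices (?F D) m"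
      unfolding simplices_half_translates using that by blast
  qed
  \<comment> \<open>With g = r(g) b and r(gx) = g x b'^-1, the element d = (r(g) s)^-1 r(gx) equals
    s^-1 b x b'^-1. It thus lies in a compact set depending only on \<open>C\<close>, and it lies in
    \<open>H\<close> because both factors do.\<close>
  have retract: "\<exists>D. compactin (subtopology T H) D \<and> (\<forall>m xs. xs \<in> simplices (?F C) m \<longrightarrow> map r xs \<in> simplices (?E D) m)"
    if C: "compactin T C" for C
  proof (intro exI conjI allI impI)
    note CG = G.compactin_carrier[OF C]
    let ?D = "{inv\<^bsub>G\<^esub> s} <#>\<^bsub>G\<^esub> B <#>\<^bsub>G\<^esub> C <#>\<^bsub>G\<^esub> m_inv G ` B"
    have sG: "s \<in> carrier G" using s(1) HG by blast
    have "compactin T ?D"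
      by (intro G.compactin_set_mult G.compactin_singleton G.compactin_set_inv G.inv_closed sG B C)
    \<comment> \<open>Closedness of \<open>H\<close> makes this intersection compact.\<close>
    then show "compactin (subtopology T H) (H \<inter> ?D)"
      by (simp add: compactin_subtopology closed_Int_compactin assms(3))
    fix m xs assume "xs \<in> simplices (?F C) m"
    then obtain g where g: "g \<in> half_group G chi" "set xs \<subseteq> (\<lambda>x. g \<otimes>\<^bsub>G\<^esub> x) ` C" and len: "length xs = Suc m"
      by (auto simp: simplices_half_translates)
    have gG: "g \<in> carrier G" using g(1) by (simp add: half_group_def)
    \<comment> \<open>The common translating element must lie in the half group of \<open>H\<close>;
      the factor \<open>s\<close> restores nonnegativity of the character.\<close>
    let ?h = "r g \<otimes>\<^bsub>G\<^esub> s"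
    have h: "?h \<in> H" using r(1)[OF gG] s(1) subgroup.m_closed[OF H] by blast
    have "r (g \<otimes>\<^bsub>G\<^esub> x) \<in> (\<lambda>x. ?h \<otimes>\<^bsub>G\<^esub> x) ` (H \<inter> ?D)" if x: "x \<in> C" for x
    proof
      let ?d = "inv\<^bsub>G\<^esub> ?h \<otimes>\<^bsub>G\<^esub> r (g \<otimes>\<^bsub>G\<^esub> x)"
      have xG: "x \<in> carrier G" using x CG by blast
      have rH: "r (g \<otimes>\<^bsub>G\<^esub> x) \<in> H" using r(1) gG xG by simp
      have rG: "r g \<in> carrier G" using r(1)[OF gG] HG by blast
      show "r (g \<otimes>\<^bsub>G\<^esub> x) = ?h \<otimes>\<^bsub>G\<^esub> ?d"
        using h rH HG by (simp add: G.m_assoc[symmetric] subset_iff)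
      obtain b where b: "b \<in> B" "g = r g \<otimes>\<^bsub>G\<^esub> b" using r(3)[OF gG] by blast
      obtain b' where b': "b' \<in> B" "r (g \<otimes>\<^bsub>G\<^esub> x) = g \<otimes>\<^bsub>G\<^esub> (x \<otimes>\<^bsub>G\<^esub> inv\<^bsub>G\<^esub> b')"
        using r_eq[OF gG xG] by blast
      have bG: "b \<in> carrier G" "b' \<in> carrier G" using b b' BG by auto
      have "inv\<^bsub>G\<^esub> (r g) \<otimes>\<^bsub>G\<^esub> g = b"
        using b(2) rG bG by (metis G.inv_solve_left' gG)
      then have "?d = inv\<^bsub>G\<^esub> s \<otimes>\<^bsub>G\<^esub> b \<otimes>\<^bsub>G\<^esub> x \<otimes>\<^bsub>G\<^esub> inv\<^bsub>G\<^esub> b'"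
        using b'(2) rG sG gG bG xG by (simp add: G.inv_mult_group G.m_assoc[symmetric]) (simp add: G.m_assoc)
      then have "?d \<in> ?D"
        using b(1) b'(1) x by (auto simp: set_mult_def)
      then show "?d \<in> H \<inter> ?D"
        using h rH subgroup.m_closed[OF H] subgroup.m_inv_closed[OF H] by blast
    qed
    then have "set (map r xs) \<subseteq> (\<lambda>x. ?h \<otimes>\<^bsub>G\<^esub> x) ` (H \<inter> ?D)"
      using g(2) by auto
    then show "map r xs \<in> simplices (?E (H \<inter> ?D)) m"
      using len h s(2)[OF g(1)] unfolding simplices_half_translates half by auto
  qed
  have subF: "simplicial_subset (?F C) (E_sset (carrier G))" if "compactin T C" for C
    by (rule G.simplicial_subset_half_translates[OF chi that])
  have subE: "simplicial_subset (?E C) (E_sset H)" if "compactin (subtopology T H) C" for C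
    using K.simplicial_subset_half_translates[OF chiH that] by simp
  have "half_connected_at m G T chi \<one>\<^bsub>G\<^esub> \<longleftrightarrow>
      half_connected_at m (G\<lparr>carrier := H\<rparr>) (subtopology T H) (restrict chi H) \<one>\<^bsub>G\<^esub>" for m
  proof
    assume conn: "half_connected_at m G T chi \<one>\<^bsub>G\<^esub>"
    show "half_connected_at m (G\<lparr>carrier := H\<rparr>) (subtopology T H) (restrict chi H) \<one>\<^bsub>G\<^esub>"
      unfolding half_connected_at_def
    proof (intro allI impI)
      fix k C
      assume k: "int k \<le> m" and C: "compactin (subtopology T H) C" and x: "[\<one>\<^bsub>G\<^esub>] \<in> simplices (?E C) 0"
      have CT: "compactin T C" using C by (simp add: compactin_subtopology)
      obtain D where D: "compactin T D" "C \<subseteq> D" and triv: "inclusion_trivial k (?F C) (?F D) [\<one>\<^bsub>G\<^esub>]"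
        using conn k CT x incl[of C C 0] unfolding half_connected_at_def by blast
      obtain D' where D': "compactin (subtopology T H) D'"
        "\<And>m xs. xs \<in> simplices (?F D) m \<Longrightarrow> map r xs \<in> simplices (?E D') m"
        using retract[OF D(1)] by blast
      \<comment> \<open>The set \<open>D'\<close> comes from \<open>retract\<close> and is not known
        to contain \<open>C\<close>, which the later stage must do.\<close>
      have CD': "compactin (subtopology T H) (C \<union> D')"
        by (rule compactin_Un[OF C D'(1)])
      have "inclusion_trivial k (?E C) (?E (C \<union> D')) [\<one>\<^bsub>G\<^esub>]"
      \<comment> \<open>Here the maps are inclusion followed by \<open>r\<close>; their composite is
        the identity on \<open>H\<close>, so the join only repeats entries.\<close>
      proof (rule inclusion_trivial_transfer[OF subE[OF C] subE[OF CD'] subF[OF CT] subF[OF D(1)]])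
        show "map id xs \<in> simplices (?F C) n" if "xs \<in> simplices (?E C) n" for n xs
          using that incl[of C C] by auto
        show "map r xs \<in> simplices (?E (C \<union> D')) n" if "xs \<in> simplices (?F D) n" for n xs
          using D'(2)[OF that] half_translates_mono[of D' "C \<union> D'"] by blast
        show "simplices (?F C) n \<subseteq> simplices (?F D) n" for n
          by (rule half_translates_mono[OF D(2)])
        show "xs @ map (r \<circ> id) xs \<in> simplices (?E (C \<union> D')) (Suc (n + n))"
          if xs: "xs \<in> simplices (?E C) n" for n xs
        proof -
          have "map (r \<circ> id) xs = xs"
            using simplicial_subset_E_ssetD(4)[OF subE[OF C] xs] r(2) by (intro map_idI) auto
          then show ?thesis
            using xs unfolding simplices_half_translates by auto
        qed
        show "r (id \<one>\<^bsub>G\<^esub>) = \<one>\<^bsub>G\<^esub>" using one by simp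
        show "inclusion_trivial k (?F C) (?F D) [id \<one>\<^bsub>G\<^esub>]" using triv by simp
      qed (rule x)
      then show "\<exists>D. compactin (subtopology T H) D \<and> C \<subseteq> D \<and> inclusion_trivial k (?E C) (?E D) [\<one>\<^bsub>G\<^esub>]"
        using CD' by blast
    qed
  next
    assume conn: "half_connected_at m (G\<lparr>carrier := H\<rparr>) (subtopology T H) (restrict chi H) \<one>\<^bsub>G\<^esub>"
    show "half_connected_at m G T chi \<one>\<^bsub>G\<^esub>"
      unfolding half_connected_at_def
    proof (intro allI impI)
      fix k C
      assume k: "int k \<le> m" and C: "compactin T C" and x: "[\<one>\<^bsub>G\<^esub>] \<in> simplices (?F C) 0"
      note CG = G.compactin_carrier[OF C]
      obtain D where D: "compactin (subtopology T H) D"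
        "\<And>m xs. xs \<in> simplices (?F C) m \<Longrightarrow> map r xs \<in> simplices (?E D) m"
        using retract[OF C] by blast
      have "[\<one>\<^bsub>G\<^esub>] \<in> simplices (?E D) 0"
        using D(2)[OF x] one by simp
      then obtain D' where D': "compactin (subtopology T H) D'" "D \<subseteq> D'"
        and triv: "inclusion_trivial k (?E D) (?E D') [\<one>\<^bsub>G\<^esub>]"
        using conn k D(1) unfolding half_connected_at_def by blast
      \<comment> \<open>The three parts hold the original vertices, their images under
        \<open>r\<close> by \<open>r_eq\<close>, and the stage of \<open>H\<close> in which the
        spheres become trivial.\<close>
      let ?C' = "C \<union> (C <#>\<^bsub>G\<^esub> m_inv G ` B) \<union> D'"
      have C': "compactin T ?C'"
        using D'(1) by (intro compactin_Un G.compactin_set_mult G.compactin_set_inv B C)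
          (simp add: compactin_subtopology)
      have "inclusion_trivial k (?F C) (?F ?C') [\<one>\<^bsub>G\<^esub>]"
      \<comment> \<open>Now \<open>r\<close> comes first and the inclusion second. The composite
        differs from the identity, but \<open>xs\<close> and its image under \<open>r\<close> lie in
        one translate of \<open>?C'\<close> by the same \<open>g\<close>.\<close>
      proof (rule inclusion_trivial_transfer[OF subF[OF C] subF[OF C'] subE[OF D(1)] subE[OF D'(1)]])
        show "map r xs \<in> simplices (?E D) n" if "xs \<in> simplices (?F C) n" for n xs
          by (rule D(2)[OF that])
        show "map id xs \<in> simplices (?F ?C') n" if "xs \<in> simplices (?E D') n" for n xs
          using that incl[of D' ?C' n] by auto
        show "simplices (?E D) n \<subseteq> simplices (?E D') n" for n
          by (rule half_translates_mono[OF D'(2)])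
        show "xs @ map (id \<circ> r) xs \<in> simplices (?F ?C') (Suc (n + n))"
          if xs: "xs \<in> simplices (?F C) n" for n xs
        proof -
          obtain g where g: "g \<in> half_group G chi" "set xs \<subseteq> (\<lambda>x. g \<otimes>\<^bsub>G\<^esub> x) ` C" and len: "length xs = Suc n"
            using xs by (auto simp: simplices_half_translates)
          have gG: "g \<in> carrier G" using g(1) by (simp add: half_group_def)
          have "r (g \<otimes>\<^bsub>G\<^esub> x) \<in> (\<lambda>x. g \<otimes>\<^bsub>G\<^esub> x) ` (C <#>\<^bsub>G\<^esub> m_inv G ` B)" if "x \<in> C" for x
            using r_eq[OF gG, of x] that CG by (auto simp: set_mult_def)
          then have "r ` set xs \<subseteq> (\<lambda>x. g \<otimes>\<^bsub>G\<^esub> x) ` (C <#>\<^bsub>G\<^esub> m_inv G ` B)"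
            using g(2) by blast
          then have "set (xs @ map (id \<circ> r) xs) \<subseteq> (\<lambda>x. g \<otimes>\<^bsub>G\<^esub> x) ` ?C'"
            using g(2) unfolding image_Un by auto
          then show ?thesis
            using g(1) len unfolding simplices_half_translates by auto
        qed
        show "id (r \<one>\<^bsub>G\<^esub>) = \<one>\<^bsub>G\<^esub>" using one by simp
        show "inclusion_trivial k (?E D) (?E D') [r \<one>\<^bsub>G\<^esub>]" using triv one by simp
      qed (rule x)
      then show "\<exists>D. compactin T D \<and> C \<subseteq> D \<and> inclusion_trivial k (?F C) (?F D) [\<one>\<^bsub>G\<^esub>]"
        using C' by blast
    qed
  qed
  then show ?thesis
    using G.Sigma_top_iff[OF chi, of n] K.Sigma_top_iff[OF chiH, of n] by simp
qed

end
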